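(* Let $a>0$, $b>0$ and $\nu>-\tfrac12$ be real numbers with $a\le b$, and suppose that $a<2\pi$ and $b<2\pi$. Then the following convergent expansion holds: $$\sum_{n=1}^\infty \frac{e^{-an}}{(\frac12 bn)^\nu}\,J_\nu(bn)=\frac{\sqrt{\pi}}{b\,\Gamma(\nu+\frac12)}\left(1+\frac{a^2}{b^2}\right)^{\nu-\frac12}-\frac{1}{2\Gamma(1+\nu)}-\frac{2a}{b^2\,\Gamma(\nu)}\,{}_2F_1\left(1,1-\nu;\frac32;-\frac{a^2}{b^2}\right)+\frac{a}{2\pi^2}\sum_{m,n\ge 0}(-1)^m A_{m,n}\left(\frac{a}{2\pi}\right)^{2m}\left(\frac{b}{2\pi}\right)^{2n},$$ where $$A_{m,n}=\frac{\Gamma(m+n+1)\,\Gamma(m+n+\frac32)}{m!\,n!\,\Gamma(m+\frac32)\,\Gamma(n+1+\nu)}\,\zeta(2m+2n+2).$$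
   Context: $J_\nu$ is the Bessel function of the first kind of order $\nu$, ${}_2F_1$ is the Gauss hypergeometric function, $\Gamma$ is the gamma function (with $1/\Gamma(\nu)=0$ when $\nu=0$), and $\zeta$ is the Riemann zeta function.
   Formalization: The double series is summed over m first and then over n, with both sums shown to converge; as an unordered double series it diverges for some allowed values (e.g. a=b=6, where the terms are unbounded), being absolutely convergent when a+b<2π. *)

theory Defs
  imports "HOL-Analysis.Analysis"
begin

(* Intended for x > 0: since 0 powr a = 0, the value at x = 0 is 0 even for \<nu> = 0.
   The factor rGamma covers the orders at which Gamma (\<nu> + k + 1) has a pole. *)
definition Bessel_J :: "real \<Rightarrow> real \<Rightarrow> real" where
  "Bessel_J \<nu> x =
     (\<Sum>k. (-1) ^ k * rGamma (\<nu> + real k + 1) / fact k * (x / 2) powr (2 * real k + \<nu>))"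

(* The Gauss series. It is evaluated in the natural order of its terms, so that on the boundary
   z = -1 of the disc of convergence the possibly only conditionally convergent sum is meant. *)
definition hypergeom_2F1 :: "real \<Rightarrow> real \<Rightarrow> real \<Rightarrow> real \<Rightarrow> real" where
  "hypergeom_2F1 a b c z = eval_fps (fps_hypergeo [a, b] [c] 1) z"

(* Only meaningful for s > 1, where the Dirichlet series converges. *)
definition zeta_real :: "real \<Rightarrow> real" where
  "zeta_real s = (\<Sum>k. 1 / real (Suc k) powr s)"

definition A_coeff :: "real \<Rightarrow> nat \<Rightarrow> nat \<Rightarrow> real" where
  "A_coeff \<nu> m n =
     Gamma (real m + real n + 1) * Gamma (real m + real n + 3 / 2) /
       (fact m * fact n * Gamma (real m + 3 / 2) * Gamma (real n + 1 + \<nu>)) *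
     zeta_real (2 * real m + 2 * real n + 2)"

(* For a + b > 2 pi these terms are unbounded in (m, n), so they have no unordered double sum.
   For 0 < a, b < 2 pi the double series converges as the iterated series with m inner and n outer;
   with the opposite order it need not converge. *)
definition expansion_term :: "real \<Rightarrow> real \<Rightarrow> real \<Rightarrow> nat \<Rightarrow> nat \<Rightarrow> real" where
  "expansion_term a b \<nu> m n =
     (-1) ^ m * A_coeff \<nu> m n * (a / (2 * pi)) ^ (2 * m) * (b / (2 * pi)) ^ (2 * n)"

end

theory Submission
  imports Defs "HOL-Complex_Analysis.Cauchy_Integral_Formula"
begin

text \<open>
  Poisson's integral writes \<open>J\<^sub>\<nu>(x) / (x/2)\<^sup>\<nu>\<close> as an average of \<open>cos (x t)\<close> against the weight
  \<open>(1 - t\<^sup>2) powr (\<nu> - 1/2)\<close>, so the series is the average over \<open>t\<close> of \<open>Re (1 / (exp z - 1))\<close>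
  with \<open>z = a + \<i> b t\<close>. Split \<open>1 / (exp z - 1) =
      1 / z - 1/2 + B(z)\<close>, where \<open>B\<close> is holomorphic in the strip
  \<open>\<bar>Im z\<bar> < 2 * pi\<close>. Taylor expansion of \<open>B\<close> at \<open>a\<close> in powers of \<open>\<i> b t\<close>, with coefficients
      expanded in turn in
  powers of \<open>a\<close> by the Taylor series of \<open>B\<close> at \<open>0\<close> (whose coefficients are zeta values), gives the
      double series
  in the order "inner sum over \<open>m\<close>". The average of \<open>Re (1 / z)\<close> satisfies a first-order
  linear differential equation in \<open>c = a / b\<close>; the partial sums
      of the hypergeometric series satisfy the same
  equation up to an error whose integral over \<open>[0, c]\<close> tends to zero for every \<open>c \<le>
      1\<close>, including \<open>c = 1\<close>.
\<close>

subsection \<open>Poisson integral of the Bessel function\<close>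

text \<open>The Poisson weight after the substitution \<open>u = t\<^sup>2\<close>, which turns moments into Beta integrals.\<close>

definition jacobi_weight :: "real \<Rightarrow> real \<Rightarrow> real" where
  "jacobi_weight \<nu> u = u powr (-1/2) * (1 - u) powr (\<nu> - 1/2)"

definition jacobi_int :: "real \<Rightarrow> (real \<Rightarrow> real) \<Rightarrow> real" where
  "jacobi_int \<nu> f = integral {0..1} (\<lambda>u. jacobi_weight \<nu> u * f u)"

lemma jacobi_weight_nonneg: "jacobi_weight \<nu> u \<ge> 0"
  by (simp add: jacobi_weight_def)

lemma has_integral_jacobi_power:
  assumes "\<nu> > -1/2"
  shows "((\<lambda>u. jacobi_weight \<nu> u * u ^ n) has_integral Beta (real n + 1/2) (\<nu> + 1/2)) {0..1}"
proof -
  have "((\<lambda>t. t powr (real n + 1/2 - 1) * (1 - t) powr (\<nu> + 1/2 - 1)) has_integral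
          Beta (real n + 1/2) (\<nu> + 1/2)) {0..1}"
    using assms by (intro has_integral_Beta_real) auto
  moreover have "t powr (real n + 1/2 - 1) * (1 - t) powr (\<nu> + 1/2 - 1) = jacobi_weight \<nu> t * t ^ n"
    if "t \<in> {0..1}" for t
  proof (cases "t = 0")
    case False
    with that have "t > 0" by auto
    then have "t powr (real n + 1/2 - 1) = t powr (-1/2) * t ^ n"
      by (simp add: powr_realpow [symmetric] powr_add [symmetric] algebra_simps)
    then show ?thesis by (simp add: jacobi_weight_def algebra_simps)
  qed (simp add: jacobi_weight_def)
  ultimately show ?thesis
    by (subst has_integral_cong[symmetric]) auto
qed

lemma jacobi_weight_abs_integrable:
  assumes "\<nu> > -1/2"
  shows "jacobi_weight \<nu> absolutely_integrable_on {0..1}"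
  using has_integral_jacobi_power[OF assms, of 0]
  by (intro nonnegative_absolutely_integrable_1) (auto simp: has_integral_iff jacobi_weight_nonneg)

lemma jacobi_int_power:
  assumes "\<nu> > -1/2"
  shows "jacobi_int \<nu> (\<lambda>u. u ^ n) = Beta (real n + 1/2) (\<nu> + 1/2)"
  using has_integral_jacobi_power[OF assms] unfolding jacobi_int_def by (rule integral_unique)

lemma jacobi_integrable:
  assumes "\<nu> > -1/2" "continuous_on {0..1} f"
  shows "(\<lambda>u. jacobi_weight \<nu> u * f u) integrable_on {0..1}"
proof -
  have "(\<lambda>u. f u * jacobi_weight \<nu> u) absolutely_integrable_on {0..1}"
  proof (rule absolutely_integrable_bounded_measurable_product_real)
    show "f \<in> borel_measurable (lebesgue_on {0..1})"
      using assms(2) by (intro continuous_imp_measurable_on_sets_lebesgue) auto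
    show "bounded (f ` {0..1})"
      using assms(2) by (intro compact_imp_bounded compact_continuous_image) auto
  qed (use jacobi_weight_abs_integrable[OF assms(1)] in auto)
  then show ?thesis
    by (simp add: mult.commute set_lebesgue_integral_eq_integral(1))
qed

lemma jacobi_int_cong:
  assumes "\<And>u. u \<in> {0..1} \<Longrightarrow> f u = g u"
  shows "jacobi_int \<nu> f = jacobi_int \<nu> g"
  unfolding jacobi_int_def using assms by (intro integral_cong) auto

lemma jacobi_int_cmult: "jacobi_int \<nu> (\<lambda>u. c * f u) = c * jacobi_int \<nu> f"
proof -
  have "jacobi_int \<nu> (\<lambda>u. c * f u) = integral {0..1} (\<lambda>u. c * (jacobi_weight \<nu> u * f u))"
    by (simp add: jacobi_int_def mult_ac)
  then show ?thesis by (simp add: jacobi_int_def)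
qed

lemma jacobi_int_add:
  assumes "\<nu> > -1/2" "continuous_on {0..1} f" "continuous_on {0..1} g"
  shows "jacobi_int \<nu> (\<lambda>u. f u + g u) = jacobi_int \<nu> f + jacobi_int \<nu> g"
  unfolding jacobi_int_def
  using integral_add[OF jacobi_integrable[OF assms(1,2)] jacobi_integrable[OF assms(1,3)]]
  by (simp add: algebra_simps)

lemma jacobi_int_diff:
  assumes "\<nu> > -1/2" "continuous_on {0..1} f" "continuous_on {0..1} g"
  shows "jacobi_int \<nu> (\<lambda>u. f u - g u) = jacobi_int \<nu> f - jacobi_int \<nu> g"
  unfolding jacobi_int_def
  using integral_diff[OF jacobi_integrable[OF assms(1,2)] jacobi_integrable[OF assms(1,3)]]
  by (simp add: algebra_simps)

lemma jacobi_int_sum: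
  assumes "\<nu> > -1/2" "\<And>n. n < N \<Longrightarrow> continuous_on {0..1} (f n)"
  shows "jacobi_int \<nu> (\<lambda>u. \<Sum>n<(N::nat). f n u) = (\<Sum>n<N. jacobi_int \<nu> (f n))"
  using assms(2)
proof (induction N)
  case 0
  then show ?case by (simp add: jacobi_int_def)
next
  case (Suc N)
  then have "continuous_on {0..1} (\<lambda>u. \<Sum>n<N. f n u)" "continuous_on {0..1} (f N)"
    by (auto intro!: continuous_on_sum)
  with Suc show ?case
    using assms(1) by (simp add: jacobi_int_add)
qed

lemma jacobi_int_bound:
  assumes "\<nu> > -1/2" "continuous_on {0..1} f" "\<And>u. u \<in> {0..1} \<Longrightarrow> \<bar>f u\<bar> \<le> B"
  shows "\<bar>jacobi_int \<nu> f\<bar> \<le> B * Beta (1/2) (\<nu> + 1/2)"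
proof -
  have int: "(\<lambda>u. jacobi_weight \<nu> u * B) integrable_on {0..1}"
    using assms(1) by (intro jacobi_integrable) auto
  have "norm (jacobi_int \<nu> f) \<le> integral {0..1} (\<lambda>u. jacobi_weight \<nu> u * B)"
    unfolding jacobi_int_def
  proof (rule integral_norm_bound_integral)
    fix u :: real assume "u \<in> {0..1}"
    then show "norm (jacobi_weight \<nu> u * f u) \<le> jacobi_weight \<nu> u * B"
      using assms(3) jacobi_weight_nonneg[of \<nu> u] by (auto simp: abs_mult intro!: mult_left_mono)
  qed (use int jacobi_integrable[OF assms(1,2)] in auto)
  also have "\<dots> = B * Beta (1/2) (\<nu> + 1/2)"
    using jacobi_int_cmult[of \<nu> B "\<lambda>u. u^0"] jacobi_int_power[OF assms(1), of 0]
    by (simp add: jacobi_int_def)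
  finally show ?thesis by simp
qed

lemma sums_jacobi_int:
  assumes "\<nu> > -1/2" "\<And>n. continuous_on {0..1} (f n)"
    and bound: "\<And>n u. u \<in> {0..1} \<Longrightarrow> \<bar>f n u\<bar> \<le> M n" and M: "summable M"
    and sums: "\<And>u. u \<in> {0..1} \<Longrightarrow> (\<lambda>n. f n u) sums F u"
  shows "(\<lambda>n. jacobi_int \<nu> (f n)) sums jacobi_int \<nu> F"
proof -
  have "uniform_limit {0..1} (\<lambda>N u. \<Sum>n<N. f n u) (\<lambda>u. \<Sum>n. f n u) sequentially"
    using bound M by (intro Weierstrass_m_test) auto
  then have lim: "uniform_limit {0..1} (\<lambda>N u. \<Sum>n<N. f n u) F sequentially"
    using sums by (subst uniform_limit_cong'[where g = "\<lambda>N u. \<Sum>n<N. f n u" and i = "\<lambda>u. \<Sum>n. f n u"])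
      (auto simp: sums_iff)
  have contF: "continuous_on {0..1} F"
    using assms(2) by (intro uniform_limit_theorem[OF _ lim]) (auto intro!: continuous_on_sum
        always_eventually)
  define C where "C = Beta (1/2) (\<nu> + 1/2)"
  have C: "C > 0" unfolding C_def Beta_def using assms(1)
      by (auto intro!: divide_pos_pos mult_pos_pos Gamma_real_pos)
  have "(\<lambda>N. \<Sum>n<N. jacobi_int \<nu> (f n)) \<longlonglongrightarrow> jacobi_int \<nu> F"
  proof (rule metric_LIMSEQ_I)
    fix e :: real assume e: "e > 0"
    then have "eventually (\<lambda>N. \<forall>u\<in>{0..1}. dist (\<Sum>n<N. f n u) (F u) < e / (2*C)) sequentially"
      using lim C unfolding uniform_limit_iff by auto
    then obtain N0 where N0: "\<And>N u. N \<ge> N0 \<Longrightarrow> u \<in> {0..1} \<Longrightarrow> dist (\<Sum>n<N. f n u) (F u) < e / (2*C)"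
      unfolding eventually_sequentially by blast
    show "\<exists>N0. \<forall>N\<ge>N0. dist (\<Sum>n<N. jacobi_int \<nu> (f n)) (jacobi_int \<nu> F) < e"
    proof (intro exI allI impI)
      fix N assume N: "N \<ge> N0"
      have cont: "continuous_on {0..1} (\<lambda>u. \<Sum>n<N. f n u)"
        using assms(2) by (intro continuous_on_sum) auto
      have "\<bar>jacobi_int \<nu> (\<lambda>u. (\<Sum>n<N. f n u) - F u)\<bar> \<le> (e/(2*C)) * Beta (1/2) (\<nu> + 1/2)"
        using N0[OF N] cont contF
        by (intro jacobi_int_bound assms(1) continuous_on_diff) (auto simp: dist_norm less_imp_le)
      also have "\<dots> = e / 2" using C by (simp add: C_def [symmetric])
      finally show "dist (\<Sum>n<N. jacobi_int \<nu> (f n)) (jacobi_int \<nu> F) < e"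
        using e assms(1,2) cont contF by (simp add: jacobi_int_diff jacobi_int_sum dist_norm)
    qed
  qed
  then show ?thesis by (simp add: sums_def)
qed

lemma Gamma_half_plus_nat:
  "Gamma (real n + 1/2) = sqrt pi * fact (2 * n) / (4 ^ n * fact n)"
proof (induction n)
  case (Suc n)
  have "Gamma (real n + 1/2 + 1) = (real n + 1/2) * Gamma (real n + 1/2)"
    by (rule Gamma_plus1) (auto simp: add_eq_0_iff elim!: nonpos_Ints_cases)
  also have "\<dots> = (real n + 1/2) * (sqrt pi * fact (2 * n) / (4 ^ n * fact n))"
    by (simp only: Suc.IH)
  also have "\<dots> = sqrt pi * fact (2 * Suc n) / (4 ^ Suc n * fact (Suc n))"
    by (simp add: divide_simps) (simp add: algebra_simps)
  finally show ?case by (simp add: add_ac)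
qed (simp add: Gamma_one_half_real)

lemma Beta_half_plus_nat:
  "Beta (real n + 1/2) (\<nu> + 1/2) =
     sqrt pi * Gamma (\<nu> + 1/2) * (fact (2*n) / (4 ^ n * fact n) * rGamma (\<nu> + real n + 1))"
proof -
  have "real n + 1/2 + (\<nu> + 1/2) = \<nu> + real n + 1" by simp
  moreover have "s * f / d * g / h = s * g * (f / d * inverse h)" for s f d g h :: real
    by (simp add: divide_inverse)
  ultimately show ?thesis
    unfolding Beta_def Gamma_half_plus_nat rGamma_inverse_Gamma by (simp only:)
qed

lemma Bessel_J_Poisson:
  assumes "\<nu> > -1/2" "x > 0"
  shows "Bessel_J \<nu> x / (x/2) powr \<nu> =
           jacobi_int \<nu> (\<lambda>u. cos (x * sqrt u)) / (sqrt pi * Gamma (\<nu> + 1/2))"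
proof -
  define K where "K = sqrt pi * Gamma (\<nu> + 1/2)"
  have K: "K > 0" using assms Gamma_real_pos[of "\<nu> + 1/2"] by (auto simp: K_def)
  define t where "t = (\<lambda>k. (-1) ^ k * rGamma (\<nu> + real k + 1) / fact k * (x/2) ^ (2 * k))"
  have "(\<lambda>k. jacobi_int \<nu> (\<lambda>u. (-1)^k * x^(2*k) / fact (2*k) * u ^ k)) sums
          jacobi_int \<nu> (\<lambda>u. cos (x * sqrt u))"
  proof (rule sums_jacobi_int[where M = "\<lambda>k. x^(2*k) / fact (2*k)"])
    fix n and u :: real assume u: "u \<in> {0..1}"
    show "\<bar>(-1)^n * x^(2*n) / fact (2*n) * u ^ n\<bar> \<le> x^(2*n) / fact (2*n)"
      using u assms by (auto simp: abs_mult power_le_one intro!: mult_left_le divide_right_mono)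
  next
    have "summable (\<lambda>n. inverse (fact n) * x ^ n)" by (rule summable_exp)
    then have "summable ((\<lambda>n. inverse (fact n) * x ^ n) \<circ> (\<lambda>n. 2 * n))"
      using assms by (intro summable_reindex) (auto intro: injI simp: less_imp_le)
    then show "summable (\<lambda>k. x^(2*k) / fact (2*k))" by (simp add: o_def divide_inverse mult.commute)
  next
    fix u :: real assume u: "u \<in> {0..1}"
    show "(\<lambda>k. (-1)^k * x^(2*k) / fact (2*k) * u ^ k) sums cos (x * sqrt u)"
      using cos_paired[of "x * sqrt u"] u by (simp add: power_mult_distrib power_mult mult.assoc)
  qed (use assms in \<open>auto intro!: continuous_intros\<close>)
  moreover have "jacobi_int \<nu> (\<lambda>u. (-1)^k * x^(2*k) / fact (2*k) * u ^ k) = K * t k" for k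
  proof -
    have *: "(x/2)^(2*k) = x^(2*k) / 4^k" by (simp add: power_divide power_mult)
    show ?thesis
      unfolding jacobi_int_cmult jacobi_int_power[OF assms(1)] Beta_half_plus_nat K_def t_def *
      by (simp add: mult_ac)
  qed
  ultimately have "(\<lambda>k. K * t k) sums jacobi_int \<nu> (\<lambda>u. cos (x * sqrt u))" by simp
  then have *: "t sums (jacobi_int \<nu> (\<lambda>u. cos (x * sqrt u)) / K)"
    using sums_divide[of "\<lambda>k. K * t k" _ K] K by simp
  have "(\<lambda>k. (-1) ^ k * rGamma (\<nu> + real k + 1) / fact k * (x / 2) powr (2 * real k + \<nu>)) =
          (\<lambda>k. t k * (x/2) powr \<nu>)"
  proof
    fix k
    have "(x / 2) powr (2 * real k + \<nu>) = (x/2)^(2*k) * (x/2) powr \<nu>"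
      using assms by (simp add: powr_add powr_realpow [symmetric])
    then show "(-1) ^ k * rGamma (\<nu> + real k + 1) / fact k * (x / 2) powr (2 * real k + \<nu>) =
        t k * (x/2) powr \<nu>" by (simp add: t_def)
  qed
  then have "Bessel_J \<nu> x = jacobi_int \<nu> (\<lambda>u. cos (x * sqrt u)) / K * (x/2) powr \<nu>"
    using sums_mult2[OF *, of "(x/2) powr \<nu>"] unfolding Bessel_J_def by (simp add: sums_iff)
  then show ?thesis using assms by (simp add: K_def)
qed


subsection \<open>The average of the pole term\<close>

definition poisson_jacobi :: "real \<Rightarrow> real \<Rightarrow> real" where
  "poisson_jacobi \<nu> c = jacobi_int \<nu> (\<lambda>u. c / (c\<^sup>2 + u))"

lemma jacobi_weight_sqrt:
  assumes "u > 0"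
  shows "jacobi_weight \<nu> u = (1 - u) powr (\<nu> - 1/2) / sqrt u"
proof -
  have "u powr (-1/2) = inverse (u powr (1/2))" using powr_minus[of u "1/2"] by simp
  also have "\<dots> = inverse (sqrt u)" using assms by (simp only: powr_half_sqrt less_imp_le)
  finally show ?thesis unfolding jacobi_weight_def by (simp only: divide_inverse mult.commute)
qed

lemma sq_plus_pos: "c > 0 \<Longrightarrow> u \<ge> 0 \<Longrightarrow> c\<^sup>2 + u > (0::real)"
  by (simp add: add_pos_nonneg)

lemma kernel_difference:
  fixes c y u :: real
  assumes "c > 0" "y > 0" "u \<ge> 0"
  shows "y / (y\<^sup>2 + u) - c / (c\<^sup>2 + u) - (y - c) * ((u - c\<^sup>2) / (c\<^sup>2 + u)\<^sup>2) =
           - ((y - c)\<^sup>2 * (2 * u * c + u * y - c\<^sup>2 * y) / ((c\<^sup>2 + u)\<^sup>2 * (y\<^sup>2 + u)))"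
proof -
  define p q where "p = c\<^sup>2 + u" and "q = y\<^sup>2 + u"
  have pq: "p > 0" "q > 0" using assms sq_plus_pos by (auto simp: p_def q_def)
  have "y / q - c / p - (y - c) * ((u - c\<^sup>2) / p\<^sup>2) =
          (y * p\<^sup>2 - c * p * q - (y - c) * (u - c\<^sup>2) * q) / (p\<^sup>2 * q)"
    using pq by (simp add: field_simps power2_eq_square)
  also have "y * p\<^sup>2 - c * p * q - (y - c) * (u - c\<^sup>2) * q =
               - ((y - c)\<^sup>2 * (2 * u * c + u * y - c\<^sup>2 * y))"
    unfolding p_def q_def by algebra
  finally show ?thesis by (simp add: p_def q_def)
qed

lemma has_real_derivative_poisson_jacobi:
  assumes "\<nu> > -1/2" "c > 0"
  shows "(poisson_jacobi \<nu> has_real_derivative jacobi_int \<nu> (\<lambda>u. (u - c\<^sup>2) / (c\<^sup>2 + u)\<^sup>2)) (at c)"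
proof -
  define D where "D = jacobi_int \<nu> (\<lambda>u. (u - c\<^sup>2) / (c\<^sup>2 + u)\<^sup>2)"
  define M where "M = (4 * c + 2 * c ^ 3) / (c ^ 4 * (c\<^sup>2 / 4)) * Beta (1/2) (\<nu> + 1/2)"
  have nz: "y\<^sup>2 + u \<noteq> 0" if "y > 0" "u \<ge> 0" for y u :: real
    using sq_plus_pos[OF that] by simp
  have ev: "eventually (\<lambda>y. norm ((poisson_jacobi \<nu> y - poisson_jacobi \<nu> c) / (y - c) - D) \<le>
      M * \<bar>y - c\<bar>) (at c)"
  proof -
    have "eventually (\<lambda>y. y \<in> {c/2<..<2*c}) (at c)"
      using assms by (intro eventually_at_in_open') auto
    moreover have "eventually (\<lambda>y. y \<noteq> c) (at c)" by (simp add: eventually_at_filter)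
    ultimately show ?thesis
    proof eventually_elim
      case (elim y)
      then have y: "c / 2 < y" "y < 2 * c" "y > 0" "y \<noteq> c" using assms by auto
      have cont: "continuous_on {0..1} (\<lambda>u. y / (y\<^sup>2 + u))" "continuous_on {0..1} (\<lambda>u. c / (c\<^sup>2 + u))"
          "continuous_on {0..1} (\<lambda>u. (u - c\<^sup>2) / (c\<^sup>2 + u)\<^sup>2)"
          "continuous_on {0..1} (\<lambda>u. (y - c) * ((u - c\<^sup>2) / (c\<^sup>2 + u)\<^sup>2))"
        using assms y nz by (auto intro!: continuous_intros)
      define R where "R = (\<lambda>u. y / (y\<^sup>2 + u) - c / (c\<^sup>2 + u) - (y - c) * ((u - c\<^sup>2) / (c\<^sup>2 + u)\<^sup>2))"
      have "\<bar>jacobi_int \<nu> R\<bar> \<le> ((y - c)\<^sup>2 * ((4 * c +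
          2 * c ^ 3) / (c ^ 4 * (c\<^sup>2 / 4)))) * Beta (1/2) (\<nu> + 1/2)"
      proof (rule jacobi_int_bound)
        show "continuous_on {0..1} R" unfolding R_def using cont by (intro continuous_on_diff)
        fix u :: real assume u: "u \<in> {0..1}"
        have "\<bar>2 * u * c + u * y - c\<^sup>2 * y\<bar> \<le> 4 * c + 2 * c ^ 3"
        proof -
          have "u * c \<le> c" "u * y \<le> y" "u * c \<ge> 0" "u * y \<ge> 0"
            using u assms y by (simp_all add: mult_le_cancel_right1)
          moreover have "c\<^sup>2 * y \<le> c\<^sup>2 * (2 * c)" using y by (intro mult_left_mono) auto
          moreover have "c\<^sup>2 * y \<ge> 0" "c\<^sup>2 * (2 * c) =
              2 * c ^ 3" using y by (auto simp: power3_eq_cube power2_eq_square)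
          ultimately show ?thesis using y assms unfolding abs_le_iff mult.assoc by linarith
        qed
        moreover have "c ^ 4 * (c\<^sup>2 / 4) \<le> (c\<^sup>2 + u)\<^sup>2 * (y\<^sup>2 + u)"
        proof (rule mult_mono)
          have "(c\<^sup>2)\<^sup>2 \<le> (c\<^sup>2 + u)\<^sup>2" using u by (intro power_mono) auto
          then show "c ^ 4 \<le> (c\<^sup>2 + u)\<^sup>2" by simp
          have "(c/2)\<^sup>2 \<le> y\<^sup>2" using y assms by (intro power_mono) auto
          then show "c\<^sup>2 / 4 \<le> y\<^sup>2 + u" using u by (simp add: power_divide)
        qed auto
        ultimately have "\<bar>2 * u * c + u * y - c\<^sup>2 * y\<bar> / ((c\<^sup>2 + u)\<^sup>2 * (y\<^sup>2 + u)) \<le>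
            (4 * c + 2 * c ^ 3) / (c ^ 4 * (c\<^sup>2 / 4))"
          using assms by (intro frac_le) auto
        then have "(y - c)\<^sup>2 * (\<bar>2 * u * c + u * y - c\<^sup>2 * y\<bar> / ((c\<^sup>2 + u)\<^sup>2 * (y\<^sup>2 + u))) \<le>
            (y - c)\<^sup>2 * ((4 * c + 2 * c ^ 3) / (c ^ 4 * (c\<^sup>2 / 4)))"
          by (intro mult_left_mono) auto
        moreover have "\<bar>R u\<bar> = (y - c)\<^sup>2 * (\<bar>2 * u * c + u * y - c\<^sup>2 * y\<bar> / ((c\<^sup>2 + u)\<^sup>2 * (y\<^sup>2 + u)))"
          unfolding R_def using kernel_difference[OF assms(2) y(3), of u] u
          by (simp add: abs_mult)
        ultimately show "\<bar>R u\<bar> \<le> (y - c)\<^sup>2 * ((4 * c + 2 * c ^ 3) / (c ^ 4 * (c\<^sup>2 / 4)))" by simp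
      qed (rule assms)
      then have "\<bar>jacobi_int \<nu> R\<bar> \<le> (y - c)\<^sup>2 * M" by (simp add: M_def)
      moreover have "jacobi_int \<nu> R = poisson_jacobi \<nu> y - poisson_jacobi \<nu> c - (y - c) * D"
        unfolding R_def poisson_jacobi_def D_def using cont assms(1)
        by (simp only: jacobi_int_diff jacobi_int_cmult continuous_on_diff)
      ultimately have "\<bar>poisson_jacobi \<nu> y - poisson_jacobi \<nu> c - (y - c) * D\<bar> / \<bar>y - c\<bar> \<le>
          (y - c)\<^sup>2 * M / \<bar>y - c\<bar>"
        by (intro divide_right_mono) auto
      also have "(y - c)\<^sup>2 * M / \<bar>y - c\<bar> = M * \<bar>y - c\<bar>"
        using y by (cases "y > c") (auto simp: power2_eq_square field_simps)
      also have "\<bar>poisson_jacobi \<nu> y - poisson_jacobi \<nu> c - (y - c) * D\<bar> / \<bar>y - c\<bar> =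
            norm ((poisson_jacobi \<nu> y - poisson_jacobi \<nu> c) / (y - c) - D)"
        using y by (simp add: abs_divide [symmetric] diff_divide_distrib)
      finally show ?case .
    qed
  qed
  have "((\<lambda>y. M * \<bar>y - c\<bar>) \<longlongrightarrow> M * \<bar>c - c\<bar>) (at c)" by (intro tendsto_intros)
  then have "((\<lambda>y. (poisson_jacobi \<nu> y - poisson_jacobi \<nu> c) / (y - c) - D) \<longlongrightarrow> 0) (at c)"
    using ev by (intro Lim_null_comparison[OF ev]) auto
  then show ?thesis
    unfolding has_field_derivative_iff D_def[symmetric] by (rule LIM_zero_cancel)
qed

lemma poisson_jacobi_ode:
  assumes "\<nu> > -1/2" "c > 0"
  shows "(1 + c\<^sup>2) * jacobi_int \<nu> (\<lambda>u. (u - c\<^sup>2) / (c\<^sup>2 + u)\<^sup>2) =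
           (2 * \<nu> - 1) * c * poisson_jacobi \<nu> c - 2 * sqrt pi * Gamma (\<nu> + 1/2) * rGamma \<nu>"
proof -
  have nz: "c\<^sup>2 + u \<noteq> 0" "c * c + u \<noteq> 0" if "u \<ge> 0" for u :: real
    using sq_plus_pos[OF assms(2) that] by (auto simp: power2_eq_square)
  \<comment> \<open>Up to a factor, \<open>\<Phi>'\<close> is the difference of both sides under the integral, and \<open>\<Phi>\<close> vanishes at
      \<open>0\<close> and \<open>1\<close>.\<close>
  define \<Phi> where "\<Phi> = (\<lambda>u. sqrt u * (1 - u) powr (\<nu> + 1/2) / (c\<^sup>2 + u))"
  define g where "g = (\<lambda>u. (2 * \<nu> - 1) * c * (c / (c\<^sup>2 + u)) - (1 + c\<^sup>2) *
      ((u - c\<^sup>2) / (c\<^sup>2 + u)\<^sup>2) - 2 * \<nu> * u ^ 0)"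
  have "((\<lambda>u. jacobi_weight \<nu> u * g u / 2) has_integral (\<Phi> 1 - \<Phi> 0)) {0..1}"
  proof (rule fundamental_theorem_of_calculus_interior)
    show "continuous_on {0..1} \<Phi>"
      unfolding \<Phi>_def using nz assms by (auto intro!: continuous_intros continuous_on_powr')
    fix u :: real assume u: "u \<in> {0<..<1}"
    define v P where "v = sqrt u" and "P = (1 - u) powr (\<nu> - 1/2)"
    have v: "v > 0" "u = v\<^sup>2" using u by (auto simp: v_def)
    have P1: "(1 - u) powr (\<nu> + 1/2) = P * (1 - u)"
      using u powr_add[of "1 - u" "\<nu> - 1/2" 1] by (simp add: P_def add.commute)
    have w: "jacobi_weight \<nu> u = P / v"
      using u by (simp add: jacobi_weight_sqrt P_def v_def)
    have dv: "(sqrt has_real_derivative inverse v / 2) (at u)"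
      using u by (auto intro!: derivative_eq_intros simp: v_def)
    have "((\<lambda>u. (1 - u) powr (\<nu> + 1/2)) has_real_derivative
        (\<nu> + 1/2) * (1 - u) powr (\<nu> + 1/2 - 1) * (0 - 1)) (at u)"
      using u by (intro has_real_derivative_powr[THEN DERIV_chain2] derivative_intros) auto
    moreover have "(\<nu> + 1/2) * (1 - u) powr (\<nu> + 1/2 - 1) * (0 - 1) = - (\<nu> + 1/2) * P"
      by (simp add: P_def algebra_simps)
    ultimately have dP: "((\<lambda>u. (1 - u) powr (\<nu> + 1/2)) has_real_derivative - (\<nu> + 1/2) * P) (at u)"
      by (simp only:)
    have dp: "((\<lambda>u. c\<^sup>2 + u) has_real_derivative 1) (at u)" by (auto intro!: derivative_eq_intros)
    have "(\<Phi> has_real_derivative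
        ((inverse v / 2 * (1 - u) powr (\<nu> + 1/2) + v * (- (\<nu> + 1/2) * P)) * (c\<^sup>2 + u)
          - v * (1 - u) powr (\<nu> + 1/2)) / (c\<^sup>2 + u)\<^sup>2) (at u)"
      using DERIV_divide[OF DERIV_mult[OF dv dP] dp] nz[of u] u
      by (simp add: \<Phi>_def v_def power2_eq_square mult.commute)
    also have "((inverse v / 2 * (1 - u) powr (\<nu> + 1/2) + v * (- (\<nu> + 1/2) * P)) * (c\<^sup>2 + u)
          - v * (1 - u) powr (\<nu> + 1/2)) / (c\<^sup>2 + u)\<^sup>2 = jacobi_weight \<nu> u * g u / 2"
    proof -
      define p where "p = c\<^sup>2 + u"
      have p: "p \<noteq> 0" "u = p - c\<^sup>2" using nz[of u] u by (auto simp: p_def)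
      have *: "((1 - u) * p - u * (2 * \<nu> + 1) * p - 2 * u * (1 - u)) =
             ((2 * \<nu> - 1) * c\<^sup>2 * p - (1 + c\<^sup>2) * (u - c\<^sup>2) - 2 * \<nu> * p\<^sup>2)"
        unfolding p_def by algebra
      have "((inverse v / 2 * (1 - u) powr (\<nu> + 1/2) + v * (- (\<nu> + 1/2) * P)) * (c\<^sup>2 + u)
          - v * (1 - u) powr (\<nu> + 1/2)) / (c\<^sup>2 + u)\<^sup>2 =
          P / v / 2 * ((1 - u) * p - v\<^sup>2 * (2 * \<nu> + 1) * p - 2 * v\<^sup>2 * (1 - u)) / p\<^sup>2"
      proof -
        have "(inverse v / 2 * (X * t) + v * (- (\<nu> + 1/2) * X)) * p - v * (X * t) =
                X / v / 2 * (t * p - v\<^sup>2 * (2 * \<nu> + 1) * p - 2 * v\<^sup>2 * t)" for X t p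
          using v(1) by (simp add: field_simps power2_eq_square)
        then show ?thesis unfolding P1 p_def[symmetric] by (simp only: times_divide_eq_right)
      qed
      also have "\<dots> = P / v / 2 * ((2 * \<nu> - 1) * c\<^sup>2 * p - (1 + c\<^sup>2) * (u - c\<^sup>2) - 2 * \<nu> * p\<^sup>2) / p\<^sup>2"
        unfolding v(2)[symmetric] * ..
      also have "\<dots> = P / v / 2 * g u"
      proof -
        have "((2 * \<nu> - 1) * c\<^sup>2 * p - (1 + c\<^sup>2) * (u - c\<^sup>2) - 2 * \<nu> * p\<^sup>2) / p\<^sup>2 = g u"
          unfolding g_def p_def[symmetric] using p(1)
          by (simp add: field_simps power2_eq_square)
        then show ?thesis by (simp only: flip: times_divide_eq_right)
      qed
      finally show ?thesis by (simp add: w)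
    qed
    finally show "(\<Phi> has_vector_derivative jacobi_weight \<nu> u * g u / 2) (at u)"
      by (simp add: has_real_derivative_iff_has_vector_derivative)
  qed simp
  from has_integral_mult_right[OF this, of 2]
  have "((\<lambda>u. jacobi_weight \<nu> u * g u) has_integral 0) {0..1}"
    by (simp add: \<Phi>_def)
  then have "jacobi_int \<nu> g = 0" unfolding jacobi_int_def by (rule integral_unique)
  moreover have "jacobi_int \<nu> g = (2 * \<nu> - 1) * c * poisson_jacobi \<nu> c
      - (1 + c\<^sup>2) * jacobi_int \<nu> (\<lambda>u. (u - c\<^sup>2) / (c\<^sup>2 + u)\<^sup>2) - 2 * \<nu> * jacobi_int \<nu> (\<lambda>u. u ^ 0)"
  proof -
    have "continuous_on {0..1} (\<lambda>u. (2 * \<nu> - 1) * c * (c / (c\<^sup>2 + u)))"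
         "continuous_on {0..1} (\<lambda>u. (1 + c\<^sup>2) * ((u - c\<^sup>2) / (c\<^sup>2 + u)\<^sup>2))"
         "continuous_on {0..1} (\<lambda>u::real. 2 * \<nu> * u ^ 0)"
      using nz by (auto intro!: continuous_intros)
    then show ?thesis
      unfolding g_def poisson_jacobi_def using assms(1)
      by (simp only: jacobi_int_diff jacobi_int_cmult continuous_on_diff)
  qed
  moreover have "\<nu> * jacobi_int \<nu> (\<lambda>u. u ^ 0) = sqrt pi * Gamma (\<nu> + 1/2) * rGamma \<nu>"
    unfolding jacobi_int_power[OF assms(1)] Beta_half_plus_nat using rGamma_plus1[of \<nu>]
    by simp
  ultimately show ?thesis by (simp add: mult.assoc)
qed

lemma powr_minus_1_bound:
  fixes u \<mu> :: real
  assumes "0 \<le> u" "u \<le> 1" "\<bar>\<mu>\<bar> \<le> real n" "n \<ge> 1"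
  shows "\<bar>(1 - u) powr \<mu> - 1\<bar> \<le> real n * u * ((1 - u) powr \<mu> + 1)"
proof (cases "u = 1")
  case False
  with assms have u: "1 - u > 0" by simp
  have *: "1 - (1 - u) powr p \<le> real n * u" if "0 \<le> p" "p \<le> real n" for p
  proof -
    have "1 - real n * u \<le> (1 - u) ^ n"
      using Bernoulli_inequality[of "-u" n] assms by simp
    also have "\<dots> = (1 - u) powr real n" using u by (simp add: powr_realpow)
    also have "\<dots> \<le> (1 - u) powr p" using that u assms by (intro powr_mono') auto
    finally show ?thesis by simp
  qed
  show ?thesis
  proof (cases "\<mu> \<ge> 0")
    case True
    have "(1 - u) powr \<mu> \<le> 1" using True u assms by (intro powr_le1) auto
    moreover have "real n * u * 1 \<le> real n * u * ((1 - u) powr \<mu> + 1)"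
      using assms by (intro mult_left_mono) auto
    ultimately show ?thesis using *[of \<mu>] True assms by linarith
  next
    case False
    have "(1 - u) powr (-\<mu>) \<le> 1" using False u assms by (intro powr_le1) auto
    then have "(1 - u) powr \<mu> \<ge> 1" using u by (simp add: powr_minus field_simps)
    then have "\<bar>(1 - u) powr \<mu> - 1\<bar> = (1 - u) powr \<mu> * (1 - (1 - u) powr (-\<mu>))"
      using u by (simp add: powr_minus field_simps)
    also have "\<dots> \<le> (1 - u) powr \<mu> * (real n * u)"
      using *[of "-\<mu>"] False assms by (intro mult_left_mono) auto
    also have "\<dots> \<le> real n * u * ((1 - u) powr \<mu> + 1)"
      using assms by (simp add: algebra_simps)
    finally show ?thesis .
  qed
qed (use assms in auto)

lemma poisson_jacobi_half:
  assumes "c > 0"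
  shows "poisson_jacobi (1/2) c = 2 * arctan (1 / c)"
proof -
  have nz: "c\<^sup>2 + u \<noteq> 0" "c * c + u \<noteq> 0" if "u \<ge> 0" for u :: real
    using sq_plus_pos[OF assms(1) that] by (auto simp: power2_eq_square)
  have "((\<lambda>u. jacobi_weight (1/2) u * (c / (c\<^sup>2 + u))) has_integral
          (2 * arctan (sqrt 1 / c) - 2 * arctan (sqrt 0 / c))) {0..1}"
  proof (rule fundamental_theorem_of_calculus_interior)
    show "continuous_on {0..1} (\<lambda>u. 2 * arctan (sqrt u / c))"
      using assms by (auto intro!: continuous_intros)
    fix u :: real assume u: "u \<in> {0<..<1}"
    define v where "v = sqrt u"
    have v: "v > 0" "u = v\<^sup>2" using u by (auto simp: v_def)
    have w: "jacobi_weight (1/2) u = 1 / v"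
      using u by (simp add: jacobi_weight_sqrt v_def)
    have "((\<lambda>u. 2 * arctan (sqrt u / c)) has_real_derivative
        2 * (inverse (1 + (v / c)\<^sup>2) * (inverse v / 2 / c))) (at u)"
      unfolding v_def using u assms by (auto intro!: derivative_eq_intros)
    also have "2 * (inverse (1 + (v / c)\<^sup>2) * (inverse v / 2 / c)) = 1 / v * (c / (c\<^sup>2 + u))"
    proof -
      have "1 + (v / c)\<^sup>2 = (c\<^sup>2 + u) / c\<^sup>2" using assms v by (simp add: field_simps)
      moreover have "2 * (inverse (p / c\<^sup>2) * (inverse v / 2 / c)) = 1 / v * (c / p)" if "p \<noteq> 0" for p
        using assms v(1) that by (simp add: field_simps power2_eq_square)
      ultimately show ?thesis using nz[of u] u
          by (simp only: greaterThanLessThan_iff less_imp_le not_False_eq_True)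
    qed
    finally show "((\<lambda>u. 2 * arctan (sqrt u / c)) has_vector_derivative jacobi_weight (1/2) u * (c /
        (c\<^sup>2 + u))) (at u)"
      by (simp add: w has_real_derivative_iff_has_vector_derivative)
  qed simp
  then show ?thesis by (simp add: poisson_jacobi_def jacobi_int_def integral_unique)
qed

lemma poisson_jacobi_at_0:
  assumes "\<nu> > -1/2"
  shows "(poisson_jacobi \<nu> \<longlongrightarrow> pi) (at_right 0)"
proof -
  define n where "n = Suc (nat \<lceil>\<bar>\<nu> - 1/2\<bar>\<rceil>)"
  have n: "n \<ge> 1" "\<bar>\<nu> - 1/2\<bar> \<le> real n" unfolding n_def by linarith+
  define B where "B = Beta (1/2) (\<nu> + 1/2) + Beta (1/2) (1/2 + 1/2 :: real)"
  have bound: "\<bar>poisson_jacobi \<nu> c - poisson_jacobi (1/2) c\<bar> \<le> real n * c * B" if c: "c > 0" for c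
  proof -
    have nz: "c\<^sup>2 + u \<noteq> 0" if "u \<ge> 0" for u :: real
      using sq_plus_pos[OF c that] by auto
    have cont: "continuous_on {0..1} (\<lambda>u. c / (c\<^sup>2 + u))" using nz by (auto intro!: continuous_intros)
    have i1: "(\<lambda>u. jacobi_weight \<nu> u * (c / (c\<^sup>2 + u))) integrable_on {0..1}"
      and i2: "(\<lambda>u. jacobi_weight (1/2) u * (c / (c\<^sup>2 + u))) integrable_on {0..1}"
      using jacobi_integrable[OF _ cont, of \<nu>] jacobi_integrable[OF _ cont, of "1/2"] assms by auto
    have i3: "(\<lambda>u. jacobi_weight \<nu> u * (real n * c)) integrable_on {0..1}"
      and i4: "(\<lambda>u. jacobi_weight (1/2) u * (real n * c)) integrable_on {0..1}"
      using assms by (auto intro!: jacobi_integrable)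
    have "norm (integral {0..1} (\<lambda>u. jacobi_weight \<nu> u * (c / (c\<^sup>2 + u)) -
        jacobi_weight (1/2) u * (c / (c\<^sup>2 + u))))
       \<le> integral {0..1} (\<lambda>u. jacobi_weight \<nu> u * (real n * c) + jacobi_weight (1/2) u * (real n * c))"
    proof (rule integral_norm_bound_integral)
      fix u :: real assume u: "u \<in> {0..1}"
      define r where "r = u powr (-1/2)"
      show "norm (jacobi_weight \<nu> u * (c / (c\<^sup>2 + u)) - jacobi_weight (1/2) u * (c / (c\<^sup>2 + u))) \<le>
              jacobi_weight \<nu> u * (real n * c) + jacobi_weight (1/2) u * (real n * c)"
      proof (cases "u = 1 \<or> u = 0")
        case False
        with u have u': "0 < u" "u < 1" by auto
        have abs: "\<bar>r * P * k - r * k\<bar> = r * (\<bar>P - 1\<bar> * k)" if "k \<ge> 0" for P k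
        proof -
          have "r * P * k - r * k = r * ((P - 1) * k)" by (simp add: algebra_simps)
          then show ?thesis using that by (simp add: abs_mult r_def)
        qed
        have "norm (jacobi_weight \<nu> u * (c / (c\<^sup>2 + u)) - jacobi_weight (1/2) u * (c / (c\<^sup>2 + u))) =
               r * (\<bar>(1 - u) powr (\<nu> - 1/2) - 1\<bar> * (c / (c\<^sup>2 + u)))"
          using u' c abs[of "c / (c\<^sup>2 + u)" "(1 - u) powr (\<nu> -
              1/2)"] by (simp add: jacobi_weight_def r_def)
        also have "\<dots> \<le> r * ((real n * u * ((1 - u) powr (\<nu> - 1/2) + 1)) * (c / u))"
          using u' c n powr_minus_1_bound[of u "\<nu> - 1/2" n]
          by (intro mult_left_mono mult_mono frac_le) (auto simp: r_def)
        also have "\<dots> = jacobi_weight \<nu> u * (real n * c) + jacobi_weight (1/2) u * (real n * c)"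
          using u' by (simp add: jacobi_weight_def r_def field_simps)
        finally show ?thesis .
      qed (auto simp: jacobi_weight_def)
    qed (use i1 i2 i3 i4 in \<open>auto intro: integrable_diff integrable_add\<close>)
    also have "\<dots> = integral {0..1} (\<lambda>u. jacobi_weight \<nu> u * (real n * c)) +
        integral {0..1} (\<lambda>u. jacobi_weight (1/2) u * (real n * c))"
      by (rule integral_add[OF i3 i4])
    also have "\<dots> = real n * c * B"
      using jacobi_int_cmult[of \<nu> "real n * c" "\<lambda>u. u^0"] jacobi_int_power[OF assms(1), of 0]
        jacobi_int_cmult[of "1/2" "real n * c" "\<lambda>u. u^0"] jacobi_int_power[of "1/2" 0]
      by (simp add: jacobi_int_def B_def algebra_simps)
    finally show ?thesis
      unfolding integral_diff[OF i1 i2] by (simp add: poisson_jacobi_def jacobi_int_def)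
  qed
  have "((\<lambda>c. real n * c * B) \<longlongrightarrow> real n * 0 * B) (at_right 0)" by (intro tendsto_intros)
  then have lim0: "((\<lambda>c. real n * c * B) \<longlongrightarrow> 0) (at_right 0)" by simp
  have "eventually (\<lambda>c. norm (poisson_jacobi \<nu> c - poisson_jacobi (1/2) c) \<le>
      real n * c * B) (at_right 0)"
    using eventually_at_right_less[of 0] by eventually_elim (simp only: real_norm_def bound)
  then have "((\<lambda>c. poisson_jacobi \<nu> c - poisson_jacobi (1/2) c) \<longlongrightarrow> 0) (at_right 0)"
    using lim0 by (rule Lim_null_comparison)
  moreover have "((\<lambda>c. 2 * arctan (inverse c)) \<longlongrightarrow> 2 * (pi / 2)) (at_right 0)"
    by (intro tendsto_mult tendsto_const filterlim_compose[OF tendsto_arctan_at_top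
        filterlim_inverse_at_top_right])
  then have "(poisson_jacobi (1/2) \<longlongrightarrow> 2 * (pi / 2)) (at_right 0)"
    by (rule Lim_transform_eventually) (auto simp: eventually_at_filter poisson_jacobi_half
        inverse_eq_divide)
  ultimately have "((\<lambda>c. (poisson_jacobi \<nu> c - poisson_jacobi (1/2) c) + poisson_jacobi (1/2) c) \<longlongrightarrow>
      0 + 2 * (pi / 2)) (at_right 0)"
    by (intro tendsto_add)
  then show ?thesis by simp
qed

lemma pochhammer_quotient_tendsto_0:
  fixes x y :: real
  assumes "x < y" "y > 0"
  shows "(\<lambda>n. pochhammer x n / pochhammer y n) \<longlonglongrightarrow> 0"
proof -
  have "rGamma y > 0" using assms by (simp add: rGamma_inverse_Gamma Gamma_real_pos)
  then have "(\<lambda>n. rGamma_series x n / rGamma_series y n * real n powr (x - y)) \<longlonglongrightarrow> rGamma x / rGamma y * 0"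
    using assms
    by (intro tendsto_intros tendsto_neg_powr filterlim_real_sequentially) auto
  then have "(\<lambda>n. rGamma_series x n / rGamma_series y n * real n powr (x - y)) \<longlonglongrightarrow> 0" by simp
  moreover have "eventually (\<lambda>n. rGamma_series x n / rGamma_series y n * real n powr (x - y) =
      pochhammer x (Suc n) / pochhammer y (Suc n)) sequentially"
    using eventually_gt_at_top[of 0]
  proof eventually_elim
    case (elim n)
    then have "real n powr (x - y) = exp (x * ln (real n)) / exp (y * ln (real n))"
      by (simp add: powr_def exp_diff left_diff_distrib)
    then show ?case by (simp add: rGamma_series_def)
  qed
  ultimately have "(\<lambda>n. pochhammer x (Suc n) / pochhammer y (Suc n)) \<longlonglongrightarrow> 0"
    by (rule Lim_transform_eventually)
  then show ?thesis by (rule LIMSEQ_imp_Suc)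
qed

lemma abs_diff_le_of_deriv_bound:
  fixes f g :: "real \<Rightarrow> real"
  assumes "x \<le> y"
    and "\<And>t. x \<le> t \<Longrightarrow> t \<le> y \<Longrightarrow> (f has_real_derivative f' t) (at t)"
    and "\<And>t. x \<le> t \<Longrightarrow> t \<le> y \<Longrightarrow> (g has_real_derivative g' t) (at t)"
    and "\<And>t. x \<le> t \<Longrightarrow> t \<le> y \<Longrightarrow> \<bar>f' t\<bar> \<le> g' t"
  shows "\<bar>f y - f x\<bar> \<le> g y - g x"
proof -
  have "g x - f x \<le> g y - f y"
    using assms(2-4)
    by (intro DERIV_nonneg_imp_nondecreasing[OF assms(1)])
       (force intro!: exI[of _ "g' _ - f' _"] derivative_intros simp: abs_le_iff)
  moreover have "g x + f x \<le> g y + f y"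
    using assms(2-4)
    by (intro DERIV_nonneg_imp_nondecreasing[OF assms(1)])
       (force intro!: exI[of _ "g' _ + f' _"] derivative_intros simp: abs_le_iff)
  ultimately show ?thesis by (simp add: abs_le_iff)
qed

lemma poisson_jacobi_hypergeom:
  assumes \<nu>: "\<nu> > -1/2" and c: "0 < c" "c \<le> 1"
  shows "poisson_jacobi \<nu> c = pi * (1 + c\<^sup>2) powr (\<nu> - 1/2) -
           2 * c * (sqrt pi * Gamma (\<nu> + 1/2) * rGamma \<nu>) * hypergeom_2F1 1 (1 - \<nu>) (3/2) (- (c\<^sup>2))"
proof -
  define \<mu> where "\<mu> = \<nu> - 1/2"
  define K where "K = sqrt pi * Gamma (\<nu> + 1/2) * rGamma \<nu>"
  define q where "q = (\<lambda>n. pochhammer (1 - \<nu>) n / pochhammer (3/2) n :: real)"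
  define h where "h = (\<lambda>N x. \<Sum>n<N. 2 * q n * (-1) ^ n * x ^ (2 * n + 1) :: real)"
  define g where "g = (\<lambda>x n. 2 * q n * (-1) ^ n * (2 * real n + 1) * x ^ (2 * n) :: real)"
  define W where "W = (\<lambda>N x. (poisson_jacobi \<nu> x + K * h N x) * (1 + x\<^sup>2) powr (- \<mu>))"
  define J where "J = (\<lambda>x. jacobi_int \<nu> (\<lambda>u. (u - x\<^sup>2) / (x\<^sup>2 + u)\<^sup>2))"
  have q_Suc: "(2 * real n + 3) * q (Suc n) = 2 * (real n + 1 - \<nu>) * q n" for n
    by (simp add: q_def pochhammer_Suc divide_simps) (simp add: algebra_simps)
  have ode: "(1 + x\<^sup>2) * (\<Sum>n<N. g x n) - 2 * \<mu> * x * h N x = 2 - g x N" for x N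
  proof (induction N)
    case (Suc N)
    have "(1 + x\<^sup>2) * g x N - 2 * \<mu> * x * (2 * q N * (-1) ^ N * x ^ (2 * N + 1)) = g x N - g x (Suc N)"
    proof -
      have "g x (Suc N) = - 2 * ((2 * real N + 3) * q (Suc N)) * (-1) ^ N * x ^ (2 * N) * x\<^sup>2"
        by (simp add: g_def power2_eq_square algebra_simps)
      then show ?thesis
        unfolding q_Suc by (simp add: g_def \<mu>_def power2_eq_square algebra_simps)
    qed
    then show ?case using Suc.IH by (simp add: h_def algebra_simps)
  qed (simp add: h_def g_def q_def)
  \<comment> \<open>The factor \<open>(1 + x\<^sup>2) powr (- \<mu>)\<close> is the integrating factor of the equation, so only the
      truncation error survives.\<close>
  have derivW: "(W N has_real_derivative
      - K * g x N * (1 + x\<^sup>2) powr (- \<mu> - 1)) (at x)" if x: "x > 0" for N x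
  proof -
    have pos: "1 + x\<^sup>2 > 0" by (simp add: add_pos_nonneg)
    have "((\<lambda>x. 2 * q n * (-1) ^ n * x ^ (2 * n + 1)) has_real_derivative g x n) (at x)" for n
      using DERIV_cmult[OF DERIV_pow[of "2 * n + 1" x UNIV], of "2 * q n * (-1) ^ n"]
      by (simp add: g_def mult.assoc add.commute)
    then have dh: "(h N has_real_derivative (\<Sum>n<N. g x n)) (at x)"
      unfolding h_def by (intro DERIV_sum)
    have dI: "(poisson_jacobi \<nu> has_real_derivative J x) (at x)"
      unfolding J_def by (rule has_real_derivative_poisson_jacobi[OF \<nu> x])
    have dP: "((\<lambda>x. (1 + x\<^sup>2) powr (- \<mu>)) has_real_derivative
        (- \<mu> * (1 + x\<^sup>2) powr (- \<mu> - 1) * (2 * x))) (at x)"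
      using pos by (auto intro!: derivative_eq_intros)
    have "(W N has_real_derivative
        (J x + K * (\<Sum>n<N. g x n)) * (1 + x\<^sup>2) powr (- \<mu>) + (- \<mu> * (1 + x\<^sup>2) powr (- \<mu> - 1) *
            (2 * x)) * (poisson_jacobi \<nu> x + K * h N x)) (at x)"
      unfolding W_def by (intro DERIV_mult DERIV_add dI DERIV_cmult dh dP)
    moreover have "(1 + x\<^sup>2) powr (- \<mu>) = (1 + x\<^sup>2) powr (- \<mu> - 1) * (1 + x\<^sup>2)"
      using powr_add[of "1 + x\<^sup>2" "-\<mu> - 1" 1] pos by simp
    ultimately have dW: "(W N has_real_derivative (1 + x\<^sup>2) powr (- \<mu> - 1) *
        ((1 + x\<^sup>2) * J x + K * ((1 + x\<^sup>2) *
            (\<Sum>n<N. g x n)) - 2 * \<mu> * x * (poisson_jacobi \<nu> x + K * h N x))) (at x)"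
      by (simp add: algebra_simps)
    have "(1 + x\<^sup>2) * J x = 2 * \<mu> * x * poisson_jacobi \<nu> x - 2 * K"
      unfolding J_def using poisson_jacobi_ode[OF \<nu> x] by (simp add: \<mu>_def K_def algebra_simps)
    moreover have "(1 + x\<^sup>2) * (\<Sum>n<N. g x n) = 2 - g x N + 2 * \<mu> * x * h N x"
      using ode[of x N] by simp
    ultimately have "(1 + x\<^sup>2) * J x + K * ((1 + x\<^sup>2) *
        (\<Sum>n<N. g x n)) - 2 * \<mu> * x * (poisson_jacobi \<nu> x + K * h N x) = - K * g x N"
      by (simp only:) (simp add: algebra_simps)
    with dW show ?thesis by (simp add: mult.commute)
  qed
  have W_limit: "(W N \<longlongrightarrow> pi) (at_right 0)" for N
  proof -
    have "(W N \<longlongrightarrow> (pi + K * h N 0) * (1 + 0\<^sup>2) powr (- \<mu>)) (at_right 0)"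
      unfolding W_def h_def by (intro tendsto_intros poisson_jacobi_at_0 \<nu>) auto
    then show ?thesis by (simp add: h_def)
  qed
  have W_bound: "\<bar>W N c - pi\<bar> \<le> 2 * \<bar>K\<bar> * \<bar>q N\<bar>" for N
  proof -
    have *: "\<bar>W N c - W N e\<bar> \<le> 2 * \<bar>K\<bar> * \<bar>q N\<bar>" if e: "0 < e" "e < c" for e
    proof -
      have "\<bar>W N c - W N e\<bar> \<le> 2 * \<bar>K\<bar> * \<bar>q N\<bar> * c ^ (2 * N + 1) - 2 * \<bar>K\<bar> * \<bar>q N\<bar> * e ^ (2 * N + 1)"
      proof (rule abs_diff_le_of_deriv_bound)
        fix t assume t: "e \<le> t" "t \<le> c"
        with e have "t > 0" by simp
        from derivW[OF this] show "(W N has_real_derivative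
            - K * g t N * (1 + t\<^sup>2) powr (- \<mu> - 1)) (at t)" .
        show "((\<lambda>x. 2 * \<bar>K\<bar> * \<bar>q N\<bar> * x ^ (2 * N + 1)) has_real_derivative
                 2 * \<bar>K\<bar> * \<bar>q N\<bar> * ((2 * real N + 1) * t ^ (2 * N))) (at t)"
          using DERIV_cmult[OF DERIV_pow[of "2 * N + 1" t UNIV], of "2 * \<bar>K\<bar> * \<bar>q N\<bar>"]
          by (simp add: add.commute)
        have "1 + t\<^sup>2 > 0" by (simp add: add_pos_nonneg)
        then have "(1 + t\<^sup>2) powr 0 = 1" by simp
        moreover have "(1 + t\<^sup>2) powr (- \<mu> - 1) \<le> (1 + t\<^sup>2) powr 0"
          using \<nu> by (intro powr_mono) (auto simp: \<mu>_def)
        ultimately have "(1 + t\<^sup>2) powr (- \<mu> - 1) \<le> 1" by simp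
        then have "\<bar>K\<bar> * \<bar>g t N\<bar> * (1 + t\<^sup>2) powr (- \<mu> - 1) \<le> \<bar>K\<bar> * \<bar>g t N\<bar> * 1"
          by (intro mult_left_mono) auto
        moreover have "\<bar>- K * g t N * (1 + t\<^sup>2) powr (- \<mu> - 1)\<bar> =
            \<bar>K\<bar> * \<bar>g t N\<bar> * (1 + t\<^sup>2) powr (- \<mu> - 1)"
          by (simp add: abs_mult)
        moreover have "\<bar>K\<bar> * \<bar>g t N\<bar> * 1 = 2 * \<bar>K\<bar> * \<bar>q N\<bar> * ((2 * real N + 1) * t ^ (2 * N))"
          using \<open>t > 0\<close> by (simp add: abs_mult g_def)
        ultimately show "\<bar>- K * g t N * (1 + t\<^sup>2) powr (- \<mu> - 1)\<bar> \<le>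
            2 * \<bar>K\<bar> * \<bar>q N\<bar> * ((2 * real N + 1) * t ^ (2 * N))"
          by (simp only:)
      qed (use e in linarith)
      also have "\<dots> \<le> 2 * \<bar>K\<bar> * \<bar>q N\<bar> * 1 - 0"
        using e c by (intro diff_mono mult_left_mono power_le_one) auto
      finally show ?thesis by simp
    qed
    have "((\<lambda>e. \<bar>W N c - W N e\<bar>) \<longlongrightarrow> \<bar>W N c - pi\<bar>) (at_right 0)"
      by (intro tendsto_intros W_limit)
    moreover have "eventually (\<lambda>e. \<bar>W N c - W N e\<bar> \<le> 2 * \<bar>K\<bar> * \<bar>q N\<bar>) (at_right 0)"
      using eventually_at_right_less[of 0] eventually_at_right_real[OF c(1)]
      by eventually_elim (use * in auto)
    ultimately show ?thesis by (rule tendsto_upperbound) auto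
  qed
  have "q \<longlonglongrightarrow> 0"
    unfolding q_def using \<nu> by (intro pochhammer_quotient_tendsto_0) auto
  then have "(\<lambda>N. 2 * \<bar>K\<bar> * \<bar>q N\<bar>) \<longlonglongrightarrow> 2 * \<bar>K\<bar> * \<bar>0\<bar>" by (intro tendsto_intros)
  then have q_lim: "(\<lambda>N. 2 * \<bar>K\<bar> * \<bar>q N\<bar>) \<longlonglongrightarrow> 0" by simp
  have "(\<lambda>N. W N c - pi) \<longlonglongrightarrow> 0"
    by (rule Lim_null_comparison[OF _ q_lim], rule always_eventually, rule allI)
       (simp only: real_norm_def W_bound)
  then have "(\<lambda>N. W N c) \<longlonglongrightarrow> pi" by (rule LIM_zero_cancel)
  then have W_lim: "(\<lambda>N. W N c * (1 + c\<^sup>2) powr \<mu> - poisson_jacobi \<nu> c) \<longlonglongrightarrow>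
      pi * (1 + c\<^sup>2) powr \<mu> - poisson_jacobi \<nu> c"
    by (intro tendsto_intros)
  have "(1 + c\<^sup>2) powr (- \<mu>) * (1 + c\<^sup>2) powr \<mu> = 1"
    by (subst powr_add [symmetric]) (auto simp: add_nonneg_eq_0_iff)
  then have "W N c * (1 + c\<^sup>2) powr \<mu> - poisson_jacobi \<nu> c = K * h N c" for N
    by (simp only: W_def mult.assoc) simp
  with W_lim have lim: "(\<lambda>N. K * h N c) \<longlonglongrightarrow> pi * (1 + c\<^sup>2) powr \<mu> - poisson_jacobi \<nu> c"
    by (simp only:)
  show ?thesis
  proof (cases "K = 0")
    case True
    then have "pi * (1 + c\<^sup>2) powr \<mu> - poisson_jacobi \<nu> c = 0"
      using lim by (simp add: LIMSEQ_const_iff)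
    then show ?thesis using True by (simp add: K_def \<mu>_def)
  next
    case False
    define F where "F = (pi * (1 + c\<^sup>2) powr \<mu> - poisson_jacobi \<nu> c) / (2 * c * K)"
    have "(\<lambda>N. K * h N c / (2 * c * K)) \<longlonglongrightarrow> F"
      unfolding F_def by (intro tendsto_divide lim tendsto_const) (use c False in auto)
    moreover have "K * h N c / (2 * c * K) =
        (\<Sum>n<N. fps_nth (fps_hypergeo [1, 1 - \<nu>] [3/2] 1) n * (- c\<^sup>2) ^ n)" for N
    proof -
      have "fps_nth (fps_hypergeo [1, 1 - \<nu>] [3/2] 1) n = q n" for n
        by (simp add: q_def flip: pochhammer_fact)
      moreover have "(- c\<^sup>2) ^ n = (-1) ^ n * c ^ (2 * n)" for n
        unfolding power_minus[of "c\<^sup>2"] power_mult ..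
      moreover have "K * h N c / (2 * c * K) = h N c / (2 * c)" using False by simp
      moreover have "2 * q n * (-1) ^ n * c ^ (2 * n + 1) / (2 * c) =
          q n * ((-1) ^ n * c ^ (2 * n))" for n
        using c by simp
      ultimately show ?thesis by (simp only: h_def sum_divide_distrib)
    qed
    ultimately have "(\<lambda>n. fps_nth (fps_hypergeo [1, 1 - \<nu>] [3/2] 1) n * (- c\<^sup>2) ^ n) sums F"
      by (simp add: sums_def)
    then have "hypergeom_2F1 1 (1 - \<nu>) (3/2) (- (c\<^sup>2)) = F"
      by (simp add: hypergeom_2F1_def eval_fps_def sums_iff)
    then show ?thesis using False c by (simp add: F_def K_def \<mu>_def)
  qed
qed


subsection \<open>Taylor expansion of the Bose function\<close>

lemma Digamma_reflection_complex:
  fixes z :: complex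
  assumes "z \<notin> \<int>"
  shows "Digamma (1 - z) - Digamma z = of_real pi * cot (of_real pi * z)"
proof -
  have nz: "z \<notin> \<int>\<^sub>\<le>\<^sub>0" "1 - z \<notin> \<int>\<^sub>\<le>\<^sub>0"
    using assms nonpos_Ints_subset_Ints Ints_diff[of 1 "1 - z"] by auto
  have s: "sin (of_real pi * z) \<noteq> 0" using assms by (subst sin_eq_0) auto
  have "((\<lambda>z. Gamma z * Gamma (1 - z)) has_field_derivative
           (Gamma z * Gamma (1 - z)) * (Digamma z - Digamma (1 - z))) (at z)"
    using nz by (auto intro!: derivative_eq_intros simp: algebra_simps)
  moreover have "((\<lambda>z. of_real pi / sin (of_real pi * z)) has_field_derivative
           (of_real pi / sin (of_real pi * z)) * (- of_real pi * cot (of_real pi * z))) (at z)"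
    using s by (auto intro!: derivative_eq_intros simp: cot_def field_simps)
  ultimately have "(of_real pi / sin (of_real pi * z)) * (Digamma z - Digamma (1 - z)) =
      (of_real pi / sin (of_real pi * z)) * (- of_real pi * cot (of_real pi * z))"
    unfolding Gamma_reflection_complex by (rule DERIV_unique)
  moreover have "of_real pi / sin (of_real pi * z) \<noteq> 0" using s by simp
  ultimately have "Digamma z - Digamma (1 - z) = - of_real pi * cot (of_real pi * z)"
    by (metis mult_left_cancel)
  then show ?thesis by (simp add: algebra_simps)
qed

text \<open>
  This is \<open>1 / (exp z - 1) - 1 / z + 1 / 2\<close> continued to the strip \<open>\<bar>Im z\<bar> < 2 * pi\<close>; the digamma
      form has no
  removable singularity at \<open>0\<close> and its derivatives there are polygamma values at \<open>1\<close>.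
\<close>

definition bose :: "complex \<Rightarrow> complex" where
  "bose z = \<i> / (2 * of_real pi) * (Digamma (1 - \<i> * z / (2 * of_real pi)) - Digamma (1 +
      \<i> * z / (2 * of_real pi)))"

lemma bose_eq:
  assumes "Re z > 0"
  shows "bose z = 1 / (exp z - 1) - 1 / z + 1 / 2"
proof -
  define w where "w = \<i> * z / (2 * of_real pi)"
  have "w = (\<i> * z) / of_real (2 * pi)" by (simp add: w_def)
  then have "Im w = Re z / (2 * pi)" by (simp only: Im_divide_of_real) simp
  then have "Im w > 0" using assms by simp
  then have w: "w \<notin> \<int>" by (auto elim!: Ints_cases)
  have "w \<noteq> 0" using w by auto
  have z: "z \<noteq> 0" using assms by auto
  define E where "E = exp (z / 2)"
  have E: "E \<noteq> 0" "exp z = E\<^sup>2" by (auto simp: E_def power2_eq_square simp flip: exp_add)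
  have "norm (exp z) > 1" using assms by simp
  then have E1: "E\<^sup>2 \<noteq> 1" using E(2) by auto
  have w2: "of_real pi * w = \<i> * (z / 2)" by (simp add: w_def)
  have "\<i> * (\<i> * (z/2)) = - (z/2)" by (simp add: mult.assoc[symmetric])
  then have cs: "cos (\<i> * (z/2)) = (inverse E + E) / 2" "sin (\<i> * (z/2)) = (inverse E - E) / (2 * \<i>)"
    unfolding cos_exp_eq sin_exp_eq by (simp_all add: E_def exp_minus)
  have "X / 2 / (Y / (2 * \<i>)) = \<i> * (X / Y)" for X Y :: complex
    by (cases "Y = 0") (simp_all add: field_simps)
  then have cot: "cot (of_real pi * w) = \<i> * ((inverse E + E) / (inverse E - E))"
    unfolding w2 cot_def cs .
  have "(inverse E + E) / (inverse E - E) = - ((E\<^sup>2 + 1) / (E\<^sup>2 - 1))"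
  proof -
    have "inverse E + E = (E\<^sup>2 + 1) / E" "inverse E - E = - ((E\<^sup>2 - 1) / E)"
      using E by (simp_all add: field_simps power2_eq_square)
    moreover have "X / E / (- (Y / E)) = - (X / Y)" for X Y using E by simp
    ultimately show ?thesis by (simp only:)
  qed
  also have "\<dots> = - (2 * (1 / (E\<^sup>2 - 1)) + 1)"
    using E1 by (simp add: divide_simps) 
  finally have quot: "(inverse E + E) / (inverse E - E) = - (2 * (1 / (E\<^sup>2 - 1)) + 1)" .
  have cot2: "cot (of_real pi * w) = - \<i> * (2 * (1 / (exp z - 1)) + 1)"
    unfolding cot quot E(2) by (rule minus_mult_commute[symmetric])
  have "Digamma (1 + w) = Digamma w + 1 / w"
    using Digamma_plus1[of w] \<open>w \<noteq> 0\<close> by (simp add: add.commute)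
  then have "Digamma (1 - w) - Digamma (1 + w) = of_real pi * cot (of_real pi * w) - 1 / w"
    using Digamma_reflection_complex[OF w] by (simp add: algebra_simps)
  also have "\<dots> = - (of_real pi * \<i>) * (2 * (1 / (exp z - 1)) + 1) + 2 * of_real pi * \<i> / z"
    unfolding cot2 using z by (simp add: w_def field_simps)
  finally have "bose z = \<i> / (2 * of_real pi) * (- (of_real pi * \<i>) *
      (2 * (1 / (exp z - 1)) + 1) + 2 * of_real pi * \<i> / z)"
    by (simp add: bose_def w_def)
  also have "\<dots> = (\<i> * \<i>) * (- (1 / (exp z - 1)) - 1 / 2 + 1 / z)"
    by (simp add: divide_simps) (simp add: algebra_simps)
  finally show ?thesis by simp
qed

definition bose_strip :: "complex set" where
  "bose_strip = {z. \<bar>Im z\<bar> < 2 * pi}"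

lemma open_bose_strip: "open bose_strip"
  unfolding bose_strip_def by (intro open_Collect_less continuous_intros)

lemma ball_subset_bose_strip: "x \<in> \<real> \<Longrightarrow> ball x (2 * pi) \<subseteq> bose_strip"
proof
  fix z assume x: "x \<in> \<real>" and "z \<in> ball x (2 * pi)"
  then have "norm (z - x) < 2 * pi" by (simp add: dist_norm norm_minus_commute)
  then show "z \<in> bose_strip"
    using abs_Im_le_cmod[of "z - x"] x by (auto simp: bose_strip_def complex_is_Real_iff)
qed

lemma bose_strip_not_nonpos_Int:
  assumes "z \<in> bose_strip"
  shows "1 - \<i> * z / (2 * of_real pi) \<notin> \<int>\<^sub>\<le>\<^sub>0" "1 + \<i> * z / (2 * of_real pi) \<notin> \<int>\<^sub>\<le>\<^sub>0"
proof -
  define t where "t = Im z / (2 * pi)"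
  have "\<i> * z / (2 * of_real pi) = (\<i> * z) / of_real (2 * pi)" by simp
  then have Re: "Re (\<i> * z / (2 * of_real pi)) = - t"
    by (simp only: Re_divide_of_real) (simp add: t_def)
  have "\<bar>t\<bar> < 1" using assms by (simp add: t_def bose_strip_def abs_divide)
  then have "Re (1 - \<i> * z / (2 * of_real pi)) > 0" "Re (1 + \<i> * z / (2 * of_real pi)) > 0"
    unfolding minus_complex.sel plus_complex.sel one_complex.sel Re by linarith+
  then show "1 - \<i> * z / (2 * of_real pi) \<notin> \<int>\<^sub>\<le>\<^sub>0" "1 + \<i> * z / (2 * of_real pi) \<notin> \<int>\<^sub>\<le>\<^sub>0"
    by (auto elim!: nonpos_Ints_cases simp del: minus_complex.sel plus_complex.sel)
qed

lemma has_field_derivative_bose_Polygamma: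
  assumes "z \<in> bose_strip"
  shows "((\<lambda>z. (\<i> / (2 * of_real pi)) ^ Suc p * ((-1) ^ p * Polygamma p (1 -
      \<i> * z / (2 * of_real pi)) - Polygamma p (1 + \<i> * z / (2 * of_real pi))))
    has_field_derivative
      (\<i> / (2 * of_real pi)) ^ Suc (Suc p) *
          ((-1) ^ Suc p * Polygamma (Suc p) (1 - \<i> * z / (2 * of_real pi)) - Polygamma (Suc p) (1 +
          \<i> * z / (2 * of_real pi)))) (at z)"
proof -
  define k where "k = \<i> / (2 * of_real pi)"
  have eq: "\<i> * z / (2 * of_real pi) = k * z" for z by (simp add: k_def)
  have nz: "1 - k * z \<notin> \<int>\<^sub>\<le>\<^sub>0" "1 + k * z \<notin> \<int>\<^sub>\<le>\<^sub>0" using bose_strip_not_nonpos_Int[OF assms]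
      by (auto simp: eq)
  have "((\<lambda>z. Polygamma p (1 - k * z)) has_field_derivative
      Polygamma (Suc p) (1 - k * z) * (- k)) (at z)"
    by (rule DERIV_chain2[where f = "Polygamma p" and g =
        "\<lambda>z. 1 - k * z"], rule has_field_derivative_Polygamma[OF nz(1)])
      (auto intro!: derivative_eq_intros)
  moreover have "((\<lambda>z. Polygamma p (1 + k * z)) has_field_derivative
      Polygamma (Suc p) (1 + k * z) * k) (at z)"
    by (rule DERIV_chain2[where f = "Polygamma p" and g =
        "\<lambda>z. 1 + k * z"], rule has_field_derivative_Polygamma[OF nz(2)])
      (auto intro!: derivative_eq_intros)
  ultimately have "((\<lambda>z. k ^ Suc p * ((-1) ^ p * Polygamma p (1 - k * z) - Polygamma p (1 +
      k * z))) has_field_derivative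
     k ^ Suc p * ((-1) ^ p * (Polygamma (Suc p) (1 - k * z) *
         (- k)) - Polygamma (Suc p) (1 + k * z) * k)) (at z)"
    by (intro DERIV_cmult DERIV_diff)
  then show ?thesis unfolding eq k_def[symmetric] by (simp add: algebra_simps)
qed

lemma higher_deriv_bose:
  assumes "z \<in> bose_strip"
  shows "(deriv ^^ p) bose z = (\<i> / (2 * of_real pi)) ^ Suc p *
           ((-1) ^ p * Polygamma p (1 - \<i> * z / (2 * of_real pi)) - Polygamma p (1 +
               \<i> * z / (2 * of_real pi)))"
  using assms
proof (induction p arbitrary: z)
  case (Suc p)
  have "(deriv ^^ Suc p) bose z = deriv ((deriv ^^ p) bose) z" by simp
  also have "\<dots> = deriv (\<lambda>z. (\<i> / (2 * of_real pi)) ^ Suc p *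
           ((-1) ^ p * Polygamma p (1 - \<i> * z / (2 * of_real pi)) - Polygamma p (1 +
               \<i> * z / (2 * of_real pi)))) z"
    using eventually_nhds_in_open[OF open_bose_strip Suc.prems]
    by (intro deriv_cong_ev) (auto elim!: eventually_mono simp: Suc.IH)
  also have "\<dots> = (\<i> / (2 * of_real pi)) ^ Suc (Suc p) *
      ((-1) ^ Suc p * Polygamma (Suc p) (1 - \<i> * z / (2 * of_real pi)) - Polygamma (Suc p) (1 +
      \<i> * z / (2 * of_real pi)))"
    by (rule DERIV_imp_deriv[OF has_field_derivative_bose_Polygamma[OF Suc.prems]])
  finally show ?case .
qed (simp add: bose_def)

lemma holomorphic_bose: "bose holomorphic_on bose_strip"
  using has_field_derivative_bose_Polygamma[of _ 0]
  unfolding holomorphic_on_def field_differentiable_def bose_def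
  by (auto intro: has_field_derivative_at_within)

lemma Polygamma_1_zeta:
  assumes "p \<ge> 1"
  shows "Polygamma p (1 :: complex) = of_real ((-1) ^ Suc p * fact p * zeta_real (real p + 1))"
proof -
  have "Polygamma p (1 :: real) = (-1) ^ Suc p * fact p * zeta_real (real p + 1)"
  proof -
    have "inverse ((1 + real k) ^ Suc p) = 1 / real (Suc k) powr (real p + 1)" for k
      using powr_realpow[of "real (Suc k)" "Suc p"] by (simp add: divide_inverse add_ac)
    then show ?thesis using assms by (simp add: Polygamma_def zeta_real_def)
  qed
  then show ?thesis using Polygamma_of_real[of 1 p] by simp
qed

lemma higher_deriv_bose_0_even: "even p \<Longrightarrow> (deriv ^^ p) bose 0 = 0"
  using higher_deriv_bose[of 0 p] by (simp add: bose_strip_def)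

lemma higher_deriv_bose_0_odd:
  "(deriv ^^ (2 * m + 1)) bose 0 =
     of_real (2 * (-1) ^ m * fact (2 * m + 1) * zeta_real (2 * real m + 2) / (2 * pi) ^ (2 * m + 2))"
proof -
  have "(deriv ^^ (2 * m + 1)) bose 0 = (\<i> / (2 * of_real pi)) ^ (2 * (m + 1)) *
      (- 2 * Polygamma (2 * m + 1) 1)"
    using higher_deriv_bose[of 0 "2 * m + 1"] by (simp add: bose_strip_def)
  also have "(\<i> / (2 * of_real pi)) ^ (2 * (m + 1)) = - ((-1) ^ m) / (of_real (2 * pi)) ^ (2 * m + 2)"
  proof -
    have "\<i> ^ (2 * (m + 1)) = - ((-1) ^ m)" by (simp add: power_mult)
    then show ?thesis unfolding power_divide by simp
  qed
  also have "Polygamma (2 * m + 1) 1 = complex_of_real (fact (2 * m + 1) * zeta_real (2 * real m + 2))"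
    by (subst Polygamma_1_zeta) (auto simp: add_ac)
  finally show ?thesis by (simp add: mult_ac)
qed

definition bose_coeff :: "real \<Rightarrow> nat \<Rightarrow> nat \<Rightarrow> real" where
  "bose_coeff a n m = 2 * (-1) ^ (m + n) * fact (2 * m + 2 * n + 1) * zeta_real (2 * real m +
      2 * real n + 2)
      / (2 * pi) ^ (2 * m + 2 * n + 2) / fact (2 * m + 1) * a ^ (2 * m + 1)"

lemma sums_higher_deriv_bose:
  assumes "\<bar>a\<bar> < 2 * pi"
  shows "summable (bose_coeff a n)"
    and "(deriv ^^ (2 * n)) bose (of_real a) = of_real (\<Sum>m. bose_coeff a n m)"
proof -
  have "(deriv ^^ (2 * n)) bose holomorphic_on ball 0 (2 * pi)"
    using holomorphic_on_subset[OF holomorphic_higher_deriv[OF holomorphic_bose open_bose_strip]]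
      ball_subset_bose_strip[of 0] by auto
  then have "(\<lambda>m. (deriv ^^ m) ((deriv ^^ (2 * n)) bose) 0 / fact m * (of_real a - 0) ^ m) sums
       (deriv ^^ (2 * n)) bose (of_real a)"
    using assms by (intro holomorphic_power_series) auto
  then have s: "(\<lambda>m. (deriv ^^ (m + 2 * n)) bose 0 / fact m * of_real a ^ m) sums
       (deriv ^^ (2 * n)) bose (of_real a)"
    by (simp add: funpow_add)
  have "(\<lambda>m. (deriv ^^ ((2 * m + 1) + 2 * n)) bose 0 / fact (2 * m + 1) * of_real a ^ (2 * m + 1)) sums
       (deriv ^^ (2 * n)) bose (of_real a)"
  proof (subst sums_mono_reindex[of "\<lambda>m. 2 * m + 1"])
    fix m assume "m \<notin> range (\<lambda>m::nat. 2 * m + 1)"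
    then have "even m" by (metis oddE rangeI)
    then show "(deriv ^^ (m + 2 * n)) bose 0 / fact m * of_real a ^ m = 0"
      by (simp add: higher_deriv_bose_0_even)
  qed (use s in \<open>auto simp: strict_mono_def\<close>)
  moreover have "(deriv ^^ ((2 * m + 1) + 2 * n)) bose 0 / fact (2 * m + 1) * of_real a ^ (2 * m + 1) =
     of_real (bose_coeff a n m)" for m
  proof -
    have eq: "(2 * m + 1) + 2 * n = 2 * (m + n) + 1" by simp
    show ?thesis
      unfolding eq higher_deriv_bose_0_odd bose_coeff_def by (simp add: algebra_simps)
  qed
  ultimately have *: "(\<lambda>m. complex_of_real (bose_coeff a n m)) sums
      (deriv ^^ (2 * n)) bose (of_real a)" by simp
  then have "summable (\<lambda>m. complex_of_real (bose_coeff a n m))" by (simp add: sums_iff)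
  then show sm: "summable (bose_coeff a n)" using summable_Re by fastforce
  then show "(deriv ^^ (2 * n)) bose (of_real a) = of_real (\<Sum>m. bose_coeff a n m)"
    using * sums_of_real[OF summable_sums[OF sm], where 'a = complex] by (metis sums_unique2)
qed

lemma sums_bose_vertical:
  assumes a: "0 < a" "a < 2 * pi" and y: "\<bar>y\<bar> < 2 * pi"
  shows "(\<lambda>n. (-1) ^ n * (\<Sum>m. bose_coeff a n m) / fact (2 * n) * y ^ (2 * n)) sums
           (Re (1 / (exp (Complex a y) - 1)) - a / (a\<^sup>2 + y\<^sup>2) + 1 / 2)"
proof -
  define c where "c = (\<lambda>n. (deriv ^^ n) bose (of_real a) / fact n)"
  define z where "z = Complex a y"
  have holo: "bose holomorphic_on ball (of_real a) (2 * pi)"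
    using holomorphic_on_subset[OF holomorphic_bose ball_subset_bose_strip] by auto
  have z: "z - of_real a = \<i> * of_real y" "cnj z - of_real a = - (\<i> * of_real y)"
    by (auto simp: z_def complex_eq_iff)
  have "dist z (of_real a) = \<bar>y\<bar>" "dist (cnj z) (of_real a) = \<bar>y\<bar>"
    unfolding dist_norm z by (simp_all add: norm_mult)
  then have "z \<in> ball (of_real a) (2 * pi)" "cnj z \<in> ball (of_real a) (2 * pi)"
    using y by (simp_all add: dist_commute)
  from this[THEN holomorphic_power_series[OF holo]]
  have "(\<lambda>n. c n * (\<i> * of_real y) ^ n) sums bose z" "(\<lambda>n. c n * (- (\<i> * of_real y)) ^ n) sums
      bose (cnj z)"
    unfolding z c_def .
  from sums_divide[OF sums_add[OF this], of 2]
  have "(\<lambda>n. (c n * (\<i> * of_real y) ^ n + c n * (- (\<i> * of_real y)) ^ n) / 2) sums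
      ((bose z + bose (cnj z)) / 2)" .
  then have "(\<lambda>n. (c (2 * n) * (\<i> * of_real y) ^ (2 * n) + c (2 * n) *
      (- (\<i> * of_real y)) ^ (2 * n)) / 2) sums ((bose z + bose (cnj z)) / 2)"
  proof (subst sums_mono_reindex[of "\<lambda>m. 2 * m"])
    fix m assume "m \<notin> range (\<lambda>m::nat. 2 * m)"
    then have "odd m" by (metis evenE rangeI)
    then show "(c m * (\<i> * of_real y) ^ m + c m * (- (\<i> * of_real y)) ^ m) / 2 = 0" by simp
  qed (auto simp: strict_mono_def)
  moreover have "(c (2 * n) * (\<i> * of_real y) ^ (2 * n) + c (2 * n) *
      (- (\<i> * of_real y)) ^ (2 * n)) / 2 =
     of_real ((-1) ^ n * (\<Sum>m. bose_coeff a n m) / fact (2 * n) * y ^ (2 * n))" for n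
  proof -
    have "(\<i> * of_real y) ^ (2 * n) = (-1) ^ n * complex_of_real y ^ (2 * n)"
         "(- (\<i> * of_real y)) ^ (2 * n) = (-1) ^ n * complex_of_real y ^ (2 * n)"
      by (simp_all add: power_mult power_mult_distrib power_minus[of "(complex_of_real y)\<^sup>2"])
    moreover have "c (2 * n) = of_real ((\<Sum>m. bose_coeff a n m) / fact (2 * n))"
      unfolding c_def using a by (subst sums_higher_deriv_bose) auto
    ultimately show ?thesis by (simp add: mult_ac)
  qed
  moreover have "(bose z + bose (cnj z)) / 2 = of_real (Re (1 / (exp z - 1)) - a / (a\<^sup>2 + y\<^sup>2) + 1 / 2)"
  proof -
    have bz: "bose z = 1 / (exp z - 1) - 1 / z + 1 / 2" using a by (intro bose_eq) (simp add: z_def)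
    have bc: "bose (cnj z) = cnj (1 / (exp z - 1) - 1 / z + 1 / 2)"
      using a by (subst bose_eq) (auto simp: z_def exp_cnj)
    have "(x + cnj x) / 2 = of_real (Re x)" for x by (simp only: complex_add_cnj) simp
    then have "(bose z + bose (cnj z)) / 2 = of_real (Re (1 / (exp z - 1) - 1 / z + 1 / 2))"
      unfolding bz bc .
    moreover have "Re (1 / z) = a / (a\<^sup>2 + y\<^sup>2)" by (simp add: z_def Re_divide)
    ultimately show ?thesis by simp
  qed
  ultimately have "(\<lambda>n. complex_of_real ((-1) ^ n * (\<Sum>m. bose_coeff a n m) / fact (2 * n) * y ^ (2
      * n))) sums
       of_real (Re (1 / (exp z - 1)) - a / (a\<^sup>2 + y\<^sup>2) + 1 / 2)" by simp
  then show ?thesis unfolding sums_of_real_iff z_def .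
qed

lemma sums_exp_cos:
  assumes "a > 0"
  shows "(\<lambda>k. exp (- a * real (Suc k)) * cos (real (Suc k) * y)) sums Re (1 / (exp (Complex a y) - 1))"
proof -
  define z where "z = Complex a y"
  define q where "q = exp (- z)"
  have "norm q < 1" using assms by (simp add: q_def z_def)
  then have "(\<lambda>k. q ^ k) sums (1 / (1 - q))" by (rule geometric_sums)
  then have "(\<lambda>k. q * q ^ k) sums (q * (1 / (1 - q)))" by (rule sums_mult)
  moreover have "q * (1 / (1 - q)) = 1 / (exp z - 1)"
  proof -
    have "norm (exp z) > 1" using assms by (simp add: z_def)
    then have "exp z \<noteq> 1" by (metis less_irrefl norm_one)
    then show ?thesis by (simp add: q_def exp_minus field_simps)
  qed
  ultimately have "(\<lambda>k. Re (q ^ Suc k)) sums Re (1 / (exp z - 1))"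
    by (intro sums_Re) simp
  moreover have "Re (q ^ Suc k) = exp (- a * real (Suc k)) * cos (real (Suc k) * y)" for k
  proof -
    have "q ^ Suc k = exp (of_nat (Suc k) * (- z))" unfolding q_def by (rule exp_of_nat_mult[symmetric])
    also have "of_nat (Suc k) * (- z) = Complex (- a * real (Suc k)) (- (real (Suc k) * y))"
      by (simp add: z_def complex_eq_iff algebra_simps)
    finally show ?thesis by (simp only: Re_exp complex.sel cos_minus)
  qed
  ultimately show ?thesis by (simp add: z_def)
qed

lemma fact_mult_Gamma_three_halves:
  "fact k * Gamma (real k + 3/2) = sqrt pi * fact (2 * k + 1) * 2 / 4 ^ Suc k"
proof -
  have "Gamma (real k + 3/2) = sqrt pi * fact (2 * Suc k) / (4 ^ Suc k * fact (Suc k))"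
    using Gamma_half_plus_nat[of "Suc k"] by (simp add: add_ac)
  also have "fact (2 * Suc k) = 2 * (real k + 1) * fact (2 * k + 1)" by (simp add: algebra_simps)
  also have "fact (Suc k) = (real k + 1) * fact k" by (simp add: algebra_simps)
  finally have "Gamma (real k + 3/2) = sqrt pi * (2 * (real k + 1) * fact (2 * k +
      1)) / (4 ^ Suc k * ((real k + 1) * fact k))" .
  moreover have "f * (s * (2 * x * F) / (P * (x * f))) =
      s * F * 2 / P" if "x \<noteq> 0" "f \<noteq> 0" for f s x F P :: real
    using that by simp
  moreover have "real k + 1 \<noteq> 0" by linarith
  ultimately show ?thesis by (simp only: fact_nonzero not_False_eq_True)
qed

lemma expansion_term_eq:
  assumes "a \<noteq> 0"
  shows "expansion_term a b \<nu> m n =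
           2 * pi\<^sup>2 / a * ((-1) ^ n * rGamma (\<nu> + real n +
               1) / (4 ^ n * fact n) * b ^ (2 * n)) * bose_coeff a n m"
proof -
  have sq: "sqrt pi \<noteq> 0" by simp
  define Z where "Z = zeta_real (2 * real m + 2 * real n + 2)"
  have "Gamma (real m + real n + 1) * Gamma (real m + real n + 3/2) =
      sqrt pi * fact (2 * m + 2 * n + 1) * 2 / 4 ^ Suc (m + n)"
    using fact_mult_Gamma_three_halves[of "m + n"] Gamma_fact[of "m + n", where 'a =
        real] by (simp add: add_ac distrib_left)
  moreover have "fact m * fact n * Gamma (real m + 3/2) * Gamma (real n + 1 + \<nu>) =
      (sqrt pi * fact (2 * m + 1) * 2 / 4 ^ Suc m) * (fact n * Gamma (\<nu> + real n + 1))"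
    unfolding fact_mult_Gamma_three_halves[symmetric] by (simp add: add_ac mult_ac)
  ultimately have "A_coeff \<nu> m n =
      (sqrt pi * fact (2 * m + 2 * n + 1) * 2 / 4 ^ Suc (m + n)) /
      ((sqrt pi * fact (2 * m + 1) * 2 / 4 ^ Suc m) * (fact n * Gamma (\<nu> + real n + 1))) * Z"
    by (simp only: A_coeff_def Z_def)
  also have "\<dots> = fact (2 * m + 2 * n + 1) / fact (2 * m + 1) / 4 ^ n / fact n * rGamma (\<nu> +
      real n + 1) * Z"
  proof -
    have "s * F * 2 / (p * r) / ((s * G * 2 / p) * (h * g)) * Z = F / G / r / h * inverse g * Z"
      if "s \<noteq> 0" "p \<noteq> 0" "G \<noteq> 0" "r \<noteq> 0" "h \<noteq> 0" for s F p r G h g :: real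
      using that by (cases "g = 0") (simp_all add: field_simps)
    moreover have "4 ^ Suc (m + n) = 4 ^ Suc m * (4 ^ n :: real)" by (simp add: power_add)
    ultimately show ?thesis
      using sq by (simp only: rGamma_inverse_Gamma power_not_zero fact_nonzero
          zero_neq_numeral[symmetric] not_False_eq_True)
  qed
  finally have A: "A_coeff \<nu> m n = fact (2 * m + 2 * n + 1) / fact (2 * m +
      1) / 4 ^ n / fact n * rGamma (\<nu> + real n + 1) * Z" .
  have "2 * pi\<^sup>2 / a * 2 * a ^ (2 * m + 1) / (2 * pi) ^ (2 * m + 2 * n + 2) * b ^ (2 * n) =
      (a / (2 * pi)) ^ (2 * m) * (b / (2 * pi)) ^ (2 * n)"
    using assms by (simp add: power_divide power_add field_simps power2_eq_square)
  moreover have "(-1) ^ n * (-1) ^ (m + n) = ((-1) ^ m :: real)" by (simp add: power_add)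
  ultimately have "expansion_term a b \<nu> m n =
      ((-1) ^ n * (-1) ^ (m + n)) * A_coeff \<nu> m n *
      (2 * pi\<^sup>2 / a * 2 * a ^ (2 * m + 1) / (2 * pi) ^ (2 * m + 2 * n + 2) * b ^ (2 * n))"
    unfolding expansion_term_def by (simp only: mult_ac)
  moreover have "e * e' * (F / G / p / f * R * Z) * (c / a * 2 * A1 / D * B) =
      c / a * (e * R / (p * f) * B) * (2 * e' * F * Z / D / G * A1)" for e e' F G p f R c A1 D B :: real
    by (simp add: mult_ac)
  ultimately show ?thesis unfolding A bose_coeff_def Z_def[symmetric] by (simp only:)
qed

theorem theorem1:
  fixes a b \<nu> :: real
  assumes "a > 0" and "b > 0" and "\<nu> > -1/2"
    and "a \<le> b" and "a < 2 * pi" and "b < 2 * pi"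
  shows "(\<forall>n. summable (\<lambda>m. expansion_term a b \<nu> m n)) \<and>
         summable (\<lambda>n. \<Sum>m. expansion_term a b \<nu> m n) \<and>
         (\<lambda>k. let n = real (Suc k)
               in exp (- a * n) / (1/2 * b * n) powr \<nu> * Bessel_J \<nu> (b * n))
         sums
          (sqrt pi / (b * Gamma (\<nu> + 1/2)) * (1 + a\<^sup>2 / b\<^sup>2) powr (\<nu> - 1/2)
           - 1 / (2 * Gamma (1 + \<nu>))
           - 2 * a / b\<^sup>2 * rGamma \<nu> * hypergeom_2F1 1 (1 - \<nu>) (3/2) (- (a\<^sup>2 / b\<^sup>2))
           + a / (2 * pi\<^sup>2) * (\<Sum>n. \<Sum>m. expansion_term a b \<nu> m n))"
proof -
  note a = \<open>a > 0\<close> and b = \<open>b > 0\<close> and \<nu> = \<open>\<nu> > -1/2\<close>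
  define K where "K = sqrt pi * Gamma (\<nu> + 1/2)"
  have K: "K > 0" using \<nu> Gamma_real_pos[of "\<nu> + 1/2"] by (auto simp: K_def)
  define d where "d = (\<lambda>n. (-1) ^ n * (\<Sum>m. bose_coeff a n m) / fact (2 * n))"
  define S where "S = (\<lambda>u. Re (1 / (exp (Complex a (b * sqrt u)) - 1)))"
  define P where "P = (\<lambda>u. a / (a\<^sup>2 + b\<^sup>2 * u))"
  have T_sums: "(\<lambda>n. d n * b ^ (2 * n) * u ^ n) sums (S u - P u + 1/2)" if u: "u \<in> {0..1}" for u
  proof -
    have "\<bar>b * sqrt u\<bar> \<le> b * 1" using u b by (simp add: abs_mult)
    then have "\<bar>b * sqrt u\<bar> < 2 * pi" using assms(6) by simp
    from sums_bose_vertical[OF a assms(5) this]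
    show ?thesis using u by (simp add: d_def S_def P_def power_mult_distrib power_mult mult.assoc)
  qed
  have d_summable: "summable (\<lambda>n. \<bar>d n * b ^ (2 * n)\<bar>)"
  proof -
    define b' where "b' = (b + 2 * pi) / 2"
    have b': "b < b'" "\<bar>b'\<bar> < 2 * pi" using b assms(6) by (auto simp: b'_def)
    have "summable (\<lambda>n. d n * (b'\<^sup>2) ^ n)"
      using sums_bose_vertical[OF a assms(5) b'(2)] by (simp add: d_def sums_iff power_mult)
    then have "summable (\<lambda>n. norm (d n * (b\<^sup>2) ^ n))"
      by (rule powser_insidea) (use b b' in \<open>auto intro!: power_strict_mono\<close>)
    then show ?thesis by (simp add: power_mult)
  qed
  have T_jacobi: "(\<lambda>n. jacobi_int \<nu> (\<lambda>u. d n * b ^ (2 * n) * u ^ n)) sums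
      jacobi_int \<nu> (\<lambda>u. S u - P u + 1/2)"
  proof (rule sums_jacobi_int[OF \<nu> _ _ d_summable T_sums])
    fix n and u :: real assume "u \<in> {0..1}"
    then show "\<bar>d n * b ^ (2 * n) * u ^ n\<bar> \<le> \<bar>d n * b ^ (2 * n)\<bar>"
      by (auto simp: abs_mult power_le_one intro!: mult_left_le)
  qed (auto intro!: continuous_intros)
  have row: "summable (\<lambda>m. expansion_term a b \<nu> m n)"
    and row_sum: "jacobi_int \<nu> (\<lambda>u. d n * b ^ (2 * n) * u ^ n) / K =
        a / (2 * pi\<^sup>2) * (\<Sum>m. expansion_term a b \<nu> m n)" for n
  proof -
    define r where "r = (-1) ^ n * rGamma (\<nu> + real n + 1) / (4 ^ n * fact n) * b ^ (2 * n)"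
    have eq: "expansion_term a b \<nu> m n = 2 * pi\<^sup>2 / a * r * bose_coeff a n m" for m
      unfolding r_def using a by (intro expansion_term_eq) auto
    have sm: "summable (bose_coeff a n)" using a assms(5) by (intro sums_higher_deriv_bose) auto
    then show "summable (\<lambda>m. expansion_term a b \<nu> m n)" unfolding eq by (rule summable_mult)
    have "jacobi_int \<nu> (\<lambda>u. d n * b ^ (2 * n) * u ^ n) / K = r * (\<Sum>m. bose_coeff a n m)"
      unfolding jacobi_int_cmult jacobi_int_power[OF \<nu>] Beta_half_plus_nat K_def[symmetric] d_def r_def
      using K by (simp add: mult_ac)
    moreover have "(\<Sum>m. expansion_term a b \<nu> m n) = 2 * pi\<^sup>2 / a * r * (\<Sum>m. bose_coeff a n m)"
      unfolding eq using sm by (rule suminf_mult)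
    ultimately show "jacobi_int \<nu> (\<lambda>u. d n * b ^ (2 * n) * u ^ n) / K =
        a / (2 * pi\<^sup>2) * (\<Sum>m. expansion_term a b \<nu> m n)"
      using a by simp
  qed
  have double: "(\<lambda>n. a / (2 * pi\<^sup>2) * (\<Sum>m. expansion_term a b \<nu> m n)) sums
      (jacobi_int \<nu> (\<lambda>u. S u - P u + 1/2) / K)"
    using sums_divide[OF T_jacobi, of K] unfolding row_sum .
  then have double_summable: "summable (\<lambda>n. \<Sum>m. expansion_term a b \<nu> m n)"
    using a by (simp add: sums_iff summable_cmult_iff)
  have double_sum: "a / (2 * pi\<^sup>2) * (\<Sum>n. \<Sum>m. expansion_term a b \<nu> m n) =
      jacobi_int \<nu> (\<lambda>u. S u - P u + 1/2) / K"
    unfolding sums_unique[OF double] by (rule suminf_mult[OF double_summable, symmetric])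
  have lhs: "(\<lambda>k. jacobi_int \<nu> (\<lambda>u. exp (- a * real (Suc k)) * cos (real (Suc k) *
      (b * sqrt u)))) sums jacobi_int \<nu> S"
  proof (rule sums_jacobi_int[OF \<nu>])
    have "(\<lambda>k. exp (- a) * exp (- a) ^ k) = (\<lambda>k. exp (- a * real (Suc k)))"
      by (auto simp: exp_of_nat_mult [symmetric] exp_add [symmetric] algebra_simps)
    then show "summable (\<lambda>k. exp (- a * real (Suc k)))"
      using summable_mult[OF summable_geometric[of "exp (- a)"], of "exp (- a)"] a by simp
    fix u show "(\<lambda>k. exp (- a * real (Suc k)) * cos (real (Suc k) * (b * sqrt u))) sums S u"
      unfolding S_def by (rule sums_exp_cos[OF a])
  qed (auto simp: abs_mult intro!: continuous_intros mult_left_le)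
  have bessel: "(let n = real (Suc k) in exp (- a * n) / (1/2 * b * n) powr \<nu> * Bessel_J \<nu> (b * n)) =
      jacobi_int \<nu> (\<lambda>u. exp (- a * real (Suc k)) * cos (real (Suc k) * (b * sqrt u))) / K" for k
  proof -
    have "Bessel_J \<nu> (b * real (Suc k)) / (b * real (Suc k) / 2) powr \<nu> =
            jacobi_int \<nu> (\<lambda>u. cos (b * real (Suc k) * sqrt u)) / K"
      unfolding K_def using b \<nu> by (intro Bessel_J_Poisson) auto
    moreover have "1/2 * b * real (Suc k) = b * real (Suc k) / 2"
      "\<And>u. real (Suc k) * (b * sqrt u) = b * real (Suc k) * sqrt u" by simp_all
    ultimately show ?thesis
      unfolding Let_def jacobi_int_cmult
          by (simp only: times_divide_eq_left times_divide_eq_right) (metis times_divide_eq_right)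
  qed
  have S_cont: "continuous_on {0..1} S"
  proof -
    have "norm (exp (Complex a y)) \<noteq> 1" for y using a by simp
    then have "exp (Complex a y) - 1 \<noteq> 0" for y by (metis eq_iff_diff_eq_0 norm_one)
    then have "continuous_on {0..1} (\<lambda>u. 1 / (exp (Complex a (b * sqrt u)) - 1))"
      unfolding Complex_eq by (intro continuous_intros) blast
    then show ?thesis unfolding S_def by (rule continuous_on_Re)
  qed
  have P_eq: "P u = 1 / b * ((a / b) / ((a / b)\<^sup>2 + u))" if "u \<in> {0..1}" for u
  proof -
    have "(a / b)\<^sup>2 + u = (a\<^sup>2 + b\<^sup>2 * u) / b\<^sup>2" using b by (simp add: field_simps)
    then show ?thesis using b by (simp add: P_def power2_eq_square)
  qed
  have P_cont: "continuous_on {0..1} P"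
  proof -
    have "a\<^sup>2 + b\<^sup>2 * u \<noteq> 0" if "u \<ge> 0" for u
      using a that by (metis add_pos_nonneg less_irrefl mult_nonneg_nonneg zero_le_power2
          zero_less_power)
    then show ?thesis unfolding P_def by (auto intro!: continuous_intros)
  qed
  have "jacobi_int \<nu> P = 1 / b * poisson_jacobi \<nu> (a / b)"
    unfolding poisson_jacobi_def jacobi_int_cmult[symmetric] by (rule jacobi_int_cong) (rule P_eq)
  also have "poisson_jacobi \<nu> (a / b) = pi * (1 + a\<^sup>2 / b\<^sup>2) powr (\<nu> - 1/2) -
           2 * (a / b) * (K * rGamma \<nu>) * hypergeom_2F1 1 (1 - \<nu>) (3/2) (- (a\<^sup>2 / b\<^sup>2))"
    unfolding K_def power_divide[symmetric] using a b assms(4) by (intro poisson_jacobi_hypergeom \<nu>) auto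
  finally have P_int: "jacobi_int \<nu> P / K =
      sqrt pi / (b * Gamma (\<nu> + 1/2)) * (1 + a\<^sup>2 / b\<^sup>2) powr (\<nu> - 1/2)
           - 2 * a / b\<^sup>2 * rGamma \<nu> * hypergeom_2F1 1 (1 - \<nu>) (3/2) (- (a\<^sup>2 / b\<^sup>2))"
  proof -
    assume *: "jacobi_int \<nu> P = 1 / b * (pi * (1 + a\<^sup>2 / b\<^sup>2) powr (\<nu> - 1/2) -
           2 * (a / b) * (K * rGamma \<nu>) * hypergeom_2F1 1 (1 - \<nu>) (3/2) (- (a\<^sup>2 / b\<^sup>2)))"
    have "pi / K = sqrt pi / Gamma (\<nu> + 1/2)" unfolding K_def
      by (simp add: real_div_sqrt flip: divide_divide_eq_left)
    moreover have "1 / b * (pi * X - 2 * (a / b) * (K * R) * F) / K =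
        pi / K / b * X - 2 * a / b\<^sup>2 * R * F" for X R F
      using K b by (simp add: field_simps power2_eq_square)
    moreover have "sqrt pi / Gamma (\<nu> + 1/2) / b = sqrt pi / (b * Gamma (\<nu> + 1/2))" by simp
    ultimately show ?thesis unfolding * by (simp only:)
  qed
  have one: "jacobi_int \<nu> (\<lambda>u. 1/2) / K = 1 / (2 * Gamma (1 + \<nu>))"
  proof -
    have "jacobi_int \<nu> (\<lambda>u. 1/2) = 1/2 * jacobi_int \<nu> (\<lambda>u. u ^ 0)"
      using jacobi_int_cmult[of \<nu> "1/2" "\<lambda>u. u ^ 0"] by simp
    also have "\<dots> = 1/2 * (K * rGamma (1 + \<nu>))"
      unfolding jacobi_int_power[OF \<nu>] Beta_half_plus_nat K_def[symmetric] by (simp add: add_ac)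
    also have "\<dots> / K = 1 / (2 * Gamma (1 +
        \<nu>))" using K by (simp add: rGamma_inverse_Gamma inverse_eq_divide)
    finally show ?thesis .
  qed
  have "jacobi_int \<nu> (\<lambda>u. S u - P u + 1/2) = jacobi_int \<nu> S - jacobi_int \<nu> P + jacobi_int \<nu> (\<lambda>u. 1/2)"
    using S_cont P_cont \<nu> by (simp add: jacobi_int_add jacobi_int_diff continuous_on_diff)
  then have "jacobi_int \<nu> (\<lambda>u. S u - P u + 1/2) / K =
      jacobi_int \<nu> S / K - jacobi_int \<nu> P / K + jacobi_int \<nu> (\<lambda>u. 1/2) / K"
    by (simp add: add_divide_distrib diff_divide_distrib)
  then have "jacobi_int \<nu> S / K = sqrt pi / (b * Gamma (\<nu> + 1/2)) * (1 + a\<^sup>2 / b\<^sup>2) powr (\<nu> - 1/2)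
           - 1 / (2 * Gamma (1 + \<nu>))
           - 2 * a / b\<^sup>2 * rGamma \<nu> * hypergeom_2F1 1 (1 - \<nu>) (3/2) (- (a\<^sup>2 / b\<^sup>2))
           + a / (2 * pi\<^sup>2) * (\<Sum>n. \<Sum>m. expansion_term a b \<nu> m n)"
    unfolding P_int one double_sum by simp
  then show ?thesis
    using row double_summable sums_divide[OF lhs, of K] unfolding bessel by simp
qed

end
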